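(* Let $n\in\mathbb{N}$ ($n\ge1$), $\nu=1/(n+1)$, $\mu_j=j\,\nu$ for $j=1,\dots,n$, $\bar\mu=(\mu_1,\dots,\mu_n)$, and $\psi_m(s)=m\,s^{1/m}$. Then the Mellin convolution $g^{(n+1),\star n}_{\bar\mu}(x,\psi_{n+1}(t))$ is the density law of the $\nu$-inverse process $\{L^{(\nu)}_t,\ t>0\}$, that is, $$l_\nu(x,t)=g^{(n+1),\star n}_{\bar\mu}(x,\psi_{n+1}(t)),\qquad x>0,\ t>0.$$
   Context: For $\gamma\neq0$, $\mu>0$, $g^\gamma_\mu(x,t)=|\gamma|\,\frac{x^{\gamma\mu-1}}{t^{\gamma\mu}\Gamma(\mu)}\exp\{-x^\gamma/t^\gamma\}$, $x,t>0$. For $\bar\mu=(\mu_1,\dots,\mu_n)$ with $\mu_j>0$, the Mellin convolution is $g^{\gamma,\star n}_{\bar\mu}(x,t)=g^\gamma_{\mu_1}\star\cdots\star g^\gamma_{\mu_n}(x,t)$, where $f_1\star f_2(x,t)=\int_0^\infty f_1(x,s)f_2(s,t)\,ds$; explicitly $g^{\gamma,\star n}_{\bar\mu}(x,t)=\int_0^\infty\cdots\int_0^\infty g^\gamma_{\mu_1}(x,s_1)g^\gamma_{\mu_2}(s_1,s_2)\cdots g^\gamma_{\mu_n}(s_{n-1},t)\,ds_1\cdots ds_{n-1}$, and $g^{\gamma,\star1}_{\bar\mu}=g^\gamma_{\mu_1}$. The superscript $(n+1)$ means $\gamma=n+1$. For $\nu\in(0,1)$, the $\nu$-stable subordinator $\{\tilde\tau^{(\nu)}_t,\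 t>0\}$ is the non-decreasing Lévy process with $E\exp\{-\lambda\tilde\tau^{(\nu)}_t\}=\exp\{-t\lambda^\nu\}$, $t,\lambda>0$, with density $h_\nu(\cdot,t)$. Its inverse process $\{L^{(\nu)}_t,\ t>0\}$ satisfies $\Pr\{L^{(\nu)}_t<x\}=\Pr\{\tilde\tau^{(\nu)}_x>t\}$, and $l_\nu(x,t)=\Pr\{L^{(\nu)}_t\in dx\}/dx=\int_t^\infty\frac{\partial}{\partial x}h_\nu(s,x)\,ds$, $x,t>0$, denotes its density. *)

theory Defs
  imports "HOL-Probability.Probability"
begin

definition g_kernel :: "real \<Rightarrow> real \<Rightarrow> real \<Rightarrow> real \<Rightarrow> real" where
  "g_kernel \<gamma> \<mu> x t =
     \<bar>\<gamma>\<bar> * (x powr (\<gamma> * \<mu> - 1) / (t powr (\<gamma> * \<mu>) * Gamma \<mu>)) * exp (- (x powr \<gamma> / t powr \<gamma>))"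

definition mellin_conv ::
    "(real \<Rightarrow> real \<Rightarrow> real) \<Rightarrow> (real \<Rightarrow> real \<Rightarrow> real) \<Rightarrow> real \<Rightarrow> real \<Rightarrow> real" where
  "mellin_conv f1 f2 x t = (LINT s:{0<..}|lborel. f1 x s * f2 s t)"

(* The parameters (mu_1, ..., mu_n) form a list.  Nesting to the right gives the iterated
   integral with integrand g_{mu_1}(x,s_1) g_{mu_2}(s_1,s_2) ... g_{mu_n}(s_{n-1},t).
   The value at the empty list is a dummy. *)
fun g_conv :: "real \<Rightarrow> real list \<Rightarrow> real \<Rightarrow> real \<Rightarrow> real" where
  "g_conv \<gamma> [] = (\<lambda>x t. 0)"
| "g_conv \<gamma> [\<mu>] = g_kernel \<gamma> \<mu>"
| "g_conv \<gamma> (\<mu> # \<mu>' # \<mu>s) = mellin_conv (g_kernel \<gamma> \<mu>) (g_conv \<gamma> (\<mu>' # \<mu>s))"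

definition \<psi> :: "nat \<Rightarrow> real \<Rightarrow> real" where
  "\<psi> m s = real m * s powr (1 / real m)"

(* Only times t >= 0 are meaningful; path properties are required almost surely. *)
locale levy_process = prob_space M for M :: "'a measure" +
  fixes X :: "real \<Rightarrow> 'a \<Rightarrow> real"
  assumes measurable_X: "\<And>t. 0 \<le> t \<Longrightarrow> random_variable borel (X t)"
    and start_zero: "AE \<omega> in M. X 0 \<omega> = 0"
    and indep_increments:
      "\<And>(t :: nat \<Rightarrow> real) k. 0 \<le> t 0 \<Longrightarrow> (\<And>i. i < k \<Longrightarrow> t i \<le> t (Suc i)) \<Longrightarrow>
         indep_vars (\<lambda>_. borel) (\<lambda>i \<omega>. X (t (Suc i)) \<omega> - X (t i) \<omega>) {..<k}"
    and stationary_increments: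
      "\<And>s t. 0 \<le> s \<Longrightarrow> 0 \<le> t \<Longrightarrow>
         distr M borel (\<lambda>\<omega>. X (s + t) \<omega> - X s \<omega>) = distr M borel (X t)"
    and cadlag_paths:
      "AE \<omega> in M. \<forall>t\<ge>0. continuous (at_right t) (\<lambda>s. X s \<omega>) \<and>
         (0 < t \<longrightarrow> (\<exists>l. ((\<lambda>s. X s \<omega>) \<longlongrightarrow> l) (at_left t)))"

locale stable_subordinator = levy_process M \<tau> for M :: "'a measure" and \<tau> +
  fixes \<nu> :: real
  assumes index: "0 < \<nu>" "\<nu> < 1"
    and mono_paths: "AE \<omega> in M. mono_on {0..} (\<lambda>t. \<tau> t \<omega>)"
    and laplace:
      "\<And>t r. 0 < t \<Longrightarrow> 0 < r \<Longrightarrow> expectation (\<lambda>\<omega>. exp (- r * \<tau> t \<omega>)) = exp (- t * r powr \<nu>)"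

(* h s t is the density of X t at the point s.  Densities are only determined almost
   everywhere; continuity in s > 0 selects the usual pointwise version, so that the partial
   derivative of h in t is meaningful. *)
definition continuous_density :: "'a measure \<Rightarrow> (real \<Rightarrow> 'a \<Rightarrow> real) \<Rightarrow> (real \<Rightarrow> real \<Rightarrow> real) \<Rightarrow> bool"
  where
  "continuous_density M X h \<longleftrightarrow>
     (\<forall>t>0. (\<forall>s. 0 \<le> h s t) \<and> continuous_on {0<..} (\<lambda>s. h s t) \<and>
            distributed M lborel (X t) (\<lambda>s. ennreal (h s t)))"

(* Specified through its one-dimensional laws only, so that the first passage process
   inf {x. \<tau> x > t} is one instance. *)
definition inverse_process :: "'a measure \<Rightarrow> (real \<Rightarrow> 'a \<Rightarrow> real) \<Rightarrow> (real \<Rightarrow> 'a \<Rightarrow> real) \<Rightarrow> bool" where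
  "inverse_process M \<tau> L \<longleftrightarrow>
     (\<forall>t>0. L t \<in> borel_measurable M \<and>
        (\<forall>x>0. measure M {\<omega> \<in> space M. L t \<omega> < x} = measure M {\<omega> \<in> space M. \<tau> x \<omega> > t}))"

definition inverse_density :: "(real \<Rightarrow> real \<Rightarrow> real) \<Rightarrow> real \<Rightarrow> real \<Rightarrow> real" where
  "inverse_density h x t = (LINT s:{t<..}|lborel. deriv (\<lambda>y. h s y) x)"

end

theory Submission
  imports Defs
begin

text \<open>
  Write \<open>m = n + 1\<close> and let \<open>K(x)\<close> be the convolution at \<open>(x, m)\<close>, the case \<open>t = 1\<close>. The Mellin moments
  of a convolution multiply; since \<open>\<Gamma>((k + 1 + m)/m) = (k + 1)/m \<sqdot> \<Gamma>((k + 1)/m)\<close>, the product telescopes in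
  \<open>k\<close>, so that \<open>K\<close> has the integer moments \<open>k! / \<Gamma>(1 + \<nu>k)\<close>. Integrating the Laplace transform of
  \<open>\<tau>\<^sub>x\<close> against \<open>r\<^bsup>\<nu>k-1\<^esup>\<close> shows that \<open>x \<tau>\<^sub>x\<^bsup>-\<nu>\<^esup>\<close> has the same moments. They grow slowly enough to
  determine the characteristic function, so \<open>K\<close> is the density of \<open>x \<tau>\<^sub>x\<^bsup>-\<nu>\<^esup>\<close>. Hence
  \<open>P(L\<^sub>t < x) = P(\<tau>\<^sub>x > t) = P(x \<tau>\<^sub>x\<^bsup>-\<nu>\<^esup> < x t\<^bsup>-\<nu>\<^esup>)\<close>, which gives the density of \<open>L\<^sub>t\<close>, and
  \<open>h(s, x) = \<nu> x s\<^bsup>-\<nu>-1\<^esup> K(x s\<^bsup>-\<nu>\<^esup>)\<close>. Finally \<open>\<partial>h/\<partial>x = - \<partial>/\<partial>s (s\<^bsup>-\<nu>\<^esup> K(x s\<^bsup>-\<nu>\<^esup>))\<close>, which is integrated over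
  \<open>s > t\<close>; the required smoothness and bounds hold because, thanks to \<open>m \<mu>\<^sub>1 = 1\<close>, \<open>K(x)\<close> is a Laplace
  transform evaluated at \<open>x\<^bsup>m\<^esup>\<close>.
\<close>

subsection \<open>Mellin moments of the kernels\<close>

text \<open>The substitution v = b x^c turns the integral into Euler's integral for Gamma(a/c). The
  nonnegative integral is used so that the result feeds Tonelli arguments without integrability side
  conditions.\<close>

lemma nn_integral_gamma_power:
  fixes a b c :: real
  assumes a: "0 < a" and b: "0 < b" and c: "0 < c"
  shows "(\<integral>\<^sup>+x\<in>{0<..}. ennreal (x powr (a - 1) * exp (- (b * x powr c))) \<partial>lborel)
           = ennreal (Gamma (a / c) / (c * b powr (a / c)))"
proof -
  define f where "f = (\<lambda>v::real. v powr (a / c - 1) / exp v)"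
  define g where "g = (\<lambda>x::real. b * x powr c)"
  define g' where "g' = (\<lambda>x::real. b * (c * x powr (c - 1)))"
  define k where "k = c * b powr (a / c)"
  have k: "0 < k" using assms by (simp add: k_def)
  have der: "(g has_field_derivative g' x) (at x within {0<..})" if "x \<in> {0<..}" for x
    unfolding g_def g'_def using that by (auto intro!: derivative_eq_intros)
  have inj: "inj_on g {0<..}"
    using b c by (intro inj_on_inverseI[where g = "\<lambda>y. (y / b) powr (1 / c)"]) (auto simp: g_def powr_powr)
  have img: "g ` {0<..} = {0<..}"
  proof (intro set_eqI iffI)
    fix y assume "y \<in> {0::real<..}"
    then have "y = g ((y / b) powr (1 / c))" "(y / b) powr (1 / c) \<in> {0<..}"
      using b c by (auto simp: g_def powr_powr)
    then show "y \<in> g ` {0<..}" by blast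
  qed (use b c in \<open>auto simp: g_def\<close>)
  have fg: "\<bar>g' x\<bar> * f (g x) = k * (x powr (a - 1) * exp (- (b * x powr c)))" if "x > 0" for x
  proof -
    have "c * (a / c - 1) = a - c" using c by (simp add: field_simps)
    then have "f (g x) = b powr (a / c - 1) * x powr (a - c) * exp (- (b * x powr c))"
      using that b c by (simp add: f_def g_def powr_mult powr_powr exp_minus divide_inverse)
    moreover have "b powr (a / c) = b * b powr (a / c - 1)"
      using b by (simp add: powr_diff)
    moreover have "x powr (a - 1) = x powr (c - 1) * x powr (a - c)"
      using that by (simp flip: powr_add)
    ultimately show ?thesis
      using that b c by (simp add: g'_def k_def)
  qed
  have f_abs: "f absolutely_integrable_on {0<..}" and f_int: "integral {0<..} f = Gamma (a / c)"
  proof -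
    have "(f has_integral Gamma (a / c)) {0..}"
      unfolding f_def using assms by (intro Gamma_integral_real) auto
    \<comment> \<open>Euler's integral runs over the closed half-line, while the substitution is a
      bijection of the open one; the null set {0} is removed.\<close>
    then have "((\<lambda>v. if v \<in> {0<..} then f v else 0) has_integral Gamma (a / c)) {0..}"
      by (rule has_integral_spike[of "{0}", rotated 2]) auto
    then have I: "(f has_integral Gamma (a / c)) {0<..}"
      by (subst (asm) has_integral_restrict) auto
    then show "integral {0<..} f = Gamma (a / c)" by (rule integral_unique)
    show "f absolutely_integrable_on {0<..}"
      using I by (intro nonnegative_absolutely_integrable_1) (auto simp: f_def)
  qed
  let ?F = "\<lambda>x. k * (x powr (a - 1) * exp (- (b * x powr c)))"
  have "(\<lambda>x. \<bar>g' x\<bar> * f (g x)) absolutely_integrable_on {0<..} \<and>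
        integral {0<..} (\<lambda>x. \<bar>g' x\<bar> * f (g x)) = Gamma (a / c)"
    using has_absolute_integral_change_of_variables_1'[OF _ der inj, of f "Gamma (a / c)"]
      img f_abs f_int by simp
  then have "((\<lambda>x. \<bar>g' x\<bar> * f (g x)) has_integral Gamma (a / c)) {0<..}"
    by (metis set_lebesgue_integral_eq_integral(1) integrable_integral)
  then have "((\<lambda>x. (\<bar>g' x\<bar> * f (g x)) / k) has_integral Gamma (a / c) / k) {0<..}"
    by (rule has_integral_divide)
  then have "((\<lambda>x. x powr (a - 1) * exp (- (b * x powr c))) has_integral Gamma (a / c) / k) {0<..}"
    by (rule has_integral_eq[rotated]) (use k fg in auto)
  from nn_integral_has_integral_lebesgue'[OF _ this] show ?thesis
    by (simp add: k_def)
qed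

section \<open>Sign, measurability and homogeneity of kernels and convolutions\<close>

lemma g_kernel_nonneg: "0 < \<mu> \<Longrightarrow> 0 \<le> g_kernel \<gamma> \<mu> x t"
  unfolding g_kernel_def by (intro mult_nonneg_nonneg divide_nonneg_nonneg) (auto intro: less_imp_le)

lemma measurable_g_kernel [measurable (raw)]:
  assumes [measurable]: "f \<in> borel_measurable N" "g \<in> borel_measurable N"
  shows "(\<lambda>z. g_kernel \<gamma> \<mu> (f z) (g z)) \<in> borel_measurable N"
  unfolding g_kernel_def by measurable

lemma measurable_g_conv [measurable]: "(\<lambda>x. g_conv \<gamma> \<mu>s x t) \<in> borel_measurable borel"
proof (induction \<gamma> \<mu>s rule: g_conv.induct)
  case (3 \<gamma> \<mu> \<mu>' \<mu>s)
  note 3 [measurable]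
  show ?case unfolding g_conv.simps mellin_conv_def set_lebesgue_integral_def by measurable
qed simp_all

lemma g_conv_nonneg: "(\<And>\<mu>. \<mu> \<in> set \<mu>s \<Longrightarrow> 0 < \<mu>) \<Longrightarrow> 0 \<le> g_conv \<gamma> \<mu>s x t"
proof (induction \<gamma> \<mu>s arbitrary: x rule: g_conv.induct)
  case (3 \<gamma> \<mu> \<mu>' \<mu>s)
  then show ?case
    unfolding g_conv.simps mellin_conv_def set_lebesgue_integral_def
    by (intro Bochner_Integration.integral_nonneg) (auto intro!: mult_nonneg_nonneg g_kernel_nonneg)
qed (simp_all add: g_kernel_nonneg)

lemma g_kernel_scale:
  assumes "0 < c" "0 < x" "0 < t"
  shows "g_kernel \<gamma> \<mu> (c * x) (c * t) = g_kernel \<gamma> \<mu> x t / c"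
  using assms by (simp add: g_kernel_def powr_mult powr_diff field_simps)

text \<open>Homogeneity of degree -1 survives the convolution: after substituting c s for s, the two
  factors contribute 1/c each and the measure contributes c.\<close>

lemma g_conv_scale:
  assumes "0 < c" "0 < x" "0 < t"
  shows "g_conv \<gamma> \<mu>s (c * x) (c * t) = g_conv \<gamma> \<mu>s x t / c"
  using assms
proof (induction \<gamma> \<mu>s arbitrary: x rule: g_conv.induct)
  case (3 \<gamma> \<mu> \<mu>' \<mu>s)
  let ?f = "\<lambda>x t s. indicator {0<..} s *\<^sub>R (g_kernel \<gamma> \<mu> x s * g_conv \<gamma> (\<mu>' # \<mu>s) s t)"
  have "(\<integral>s. ?f (c * x) (c * t) s \<partial>lborel) = c * (\<integral>s. ?f (c * x) (c * t) (0 + c * s) \<partial>lborel)"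
    using 3 by (subst lborel_integral_real_affine[where c = c and t = 0]) auto
  also have "(\<lambda>s. ?f (c * x) (c * t) (0 + c * s)) = (\<lambda>s. ?f x t s / c / c)"
    using 3 by (auto simp: indicator_def zero_less_mult_iff g_kernel_scale)
  also have "c * (\<integral>s. ?f x t s / c / c \<partial>lborel) = (\<integral>s. ?f x t s \<partial>lborel) / c"
    using 3 by simp
  finally show ?case by (simp add: mellin_conv_def set_lebesgue_integral_def)
qed (simp_all add: g_kernel_scale)

text \<open>Up to a constant, x^p times the kernel is the integrand of
  \<open>nn_integral_gamma_power\<close> with a = \<gamma> \<mu> + p, b = s^(-\<gamma>) and c =
  \<gamma>. The exponent p may be negative.\<close>

lemma nn_integral_g_kernel_moment:
  assumes pos: "0 < \<gamma>" "0 < \<mu>" "0 < s" and p: "0 < \<mu> + p / \<gamma>"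
  shows "(\<integral>\<^sup>+x\<in>{0<..}. ennreal (x powr p * g_kernel \<gamma> \<mu> x s) \<partial>lborel)
           = ennreal (s powr p * (Gamma (\<mu> + p / \<gamma>) / Gamma \<mu>))"
proof -
  let ?k = "\<gamma> / (s powr (\<gamma> * \<mu>) * Gamma \<mu>)"
  let ?e = "\<lambda>x. x powr (\<gamma> * \<mu> + p - 1) * exp (- (s powr - \<gamma> * x powr \<gamma>))"
  have k: "0 < ?k" using pos by simp
  have a: "0 < \<gamma> * \<mu> + p" "(\<gamma> * \<mu> + p) / \<gamma> = \<mu> + p / \<gamma>"
    using pos p by (auto simp: field_simps)
  have "x powr p * g_kernel \<gamma> \<mu> x s = ?k * ?e x" if "0 < x" for x
  proof -
    have "x powr (\<gamma> * \<mu> + p - 1) = x powr p * x powr (\<gamma> * \<mu> - 1)"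
      by (simp flip: powr_add add: algebra_simps)
    then show ?thesis using that pos by (simp add: g_kernel_def powr_minus_divide)
  qed
  then have "(\<integral>\<^sup>+x\<in>{0<..}. ennreal (x powr p * g_kernel \<gamma> \<mu> x s) \<partial>lborel)
      = (\<integral>\<^sup>+x. ennreal ?k * (ennreal (?e x) * indicator {0<..} x) \<partial>lborel)"
    by (intro nn_integral_cong) (auto simp: indicator_def simp del: times_divide_eq_left simp flip: ennreal_mult'[OF less_imp_le[OF k]])
  also have "\<dots> = ennreal ?k * ennreal (Gamma ((\<gamma> * \<mu> + p) / \<gamma>) / (\<gamma> * (s powr - \<gamma>) powr ((\<gamma> * \<mu> + p) / \<gamma>)))"
    using pos a by (subst nn_integral_cmult, simp, subst nn_integral_gamma_power) auto
  also have "\<dots> = ennreal (?k * (Gamma (\<mu> + p / \<gamma>) / (\<gamma> * (s powr - \<gamma>) powr (\<mu> + p / \<gamma>))))"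
    unfolding a(2) by (rule ennreal_mult'[OF less_imp_le[OF k], symmetric])
  also have "?k * (Gamma (\<mu> + p / \<gamma>) / (\<gamma> * (s powr - \<gamma>) powr (\<mu> + p / \<gamma>)))
      = s powr p * (Gamma (\<mu> + p / \<gamma>) / Gamma \<mu>)"
  proof -
    have "- \<gamma> * (\<mu> + p / \<gamma>) = - (\<gamma> * \<mu> + p)" using pos by (simp add: field_simps)
    then have "(s powr - \<gamma>) powr (\<mu> + p / \<gamma>) = s powr - (\<gamma> * \<mu> + p)"
      by (simp only: powr_powr)
    also have "\<dots> = 1 / (s powr (\<gamma> * \<mu>) * s powr p)"
      by (simp only: powr_minus_divide powr_add)
    finally show ?thesis using pos by simp
  qed
  finally show ?thesis .
qed

lemma powr_times_exp_minus_le: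
  fixes a v :: real
  assumes "0 < a" "0 < v"
  shows "v powr a * exp (- v) \<le> a powr a"
proof -
  have "v / a \<le> exp (v / a)" using exp_ge_add_one_self[of "v / a"] by linarith
  then have "(v / a) powr a \<le> exp (v / a) powr a"
    using assms by (intro powr_mono2) auto
  also have "\<dots> = exp v" using assms by (simp add: exp_powr_real)
  finally show ?thesis using assms by (simp add: powr_divide exp_minus field_simps)
qed

text \<open>In terms of v = (x/s)^\<gamma> the kernel is \<gamma> / (x Gamma(\<mu>)) times v^\<mu>
  exp(-v). The resulting bound is free of s, so inside a convolution the kernel acts as a bounded
  factor on an integrable function.\<close>

lemma g_kernel_bounded:
  assumes pos: "0 < \<gamma>" "0 < \<mu>" "0 < x" "0 < s"
  shows "g_kernel \<gamma> \<mu> x s \<le> \<gamma> / (x * Gamma \<mu>) * \<mu> powr \<mu>"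
proof -
  define v where "v = (x / s) powr \<gamma>"
  have v: "0 < v" using pos by (simp add: v_def)
  have "g_kernel \<gamma> \<mu> x s = \<gamma> / (x * Gamma \<mu>) * (v powr \<mu> * exp (- v))"
    using pos by (simp add: g_kernel_def v_def powr_powr powr_divide powr_diff field_simps)
  also have "\<dots> \<le> \<gamma> / (x * Gamma \<mu>) * \<mu> powr \<mu>"
    using pos v by (intro mult_left_mono powr_times_exp_minus_le) auto
  finally show ?thesis .
qed

text \<open>By Tonelli the x-integral can be done first; it returns s^p times a Gamma quotient,
  which leaves the p-th moment of the remaining convolution. The lemma serves twice: p = k gives the
  moments of the candidate density, and p = -1 gives the integrability behind its Laplace
  representation.\<close>

lemma nn_integral_g_conv_moment:
  assumes "0 < \<gamma>" "0 < t" "\<mu>s \<noteq> []"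
    and "\<And>\<mu>. \<mu> \<in> set \<mu>s \<Longrightarrow> 0 < \<mu>" "\<And>\<mu>. \<mu> \<in> set \<mu>s \<Longrightarrow> 0 < \<mu> + p / \<gamma>"
  shows "(\<integral>\<^sup>+x\<in>{0<..}. ennreal (x powr p * g_conv \<gamma> \<mu>s x t) \<partial>lborel)
           = ennreal (t powr p * (\<Prod>\<mu>\<leftarrow>\<mu>s. Gamma (\<mu> + p / \<gamma>) / Gamma \<mu>))"
  using assms
proof (induction \<gamma> \<mu>s arbitrary: p rule: g_conv.induct)
  case (2 \<gamma> \<mu>)
  then show ?case by (simp add: nn_integral_g_kernel_moment)
next
  case (3 \<gamma> \<mu> \<mu>' \<mu>s)
  let ?f = "\<lambda>s. g_conv \<gamma> (\<mu>' # \<mu>s) s t"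
  have f_nonneg: "0 \<le> ?f s" for s using "3.prems" by (intro g_conv_nonneg) auto
  have g_nonneg: "0 \<le> g_kernel \<gamma> \<mu> x s" for x s using "3.prems" by (intro g_kernel_nonneg) auto
  \<comment> \<open>The induction hypothesis at p = 0: the remaining convolution has finite
    mass.\<close>
  have f_int: "set_integrable lborel {0<..} ?f"
  proof -
    have "(\<integral>\<^sup>+x\<in>{0<..}. ennreal (x powr 0 * ?f x) \<partial>lborel) < \<infinity>"
      using "3.prems" by (subst "3.IH") auto
    also have "(\<integral>\<^sup>+x\<in>{0<..}. ennreal (x powr 0 * ?f x) \<partial>lborel)
        = (\<integral>\<^sup>+x. ennreal (indicator {0<..} x * ?f x) \<partial>lborel)"
      by (intro nn_integral_cong) (auto simp: indicator_def)
    finally show ?thesis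
      unfolding set_integrable_def using f_nonneg by (intro integrableI_nonneg) auto
  qed
  \<comment> \<open>\<open>mellin_conv\<close> is a Bochner integral, which is 0 by convention when
    the integrand is not integrable. Integrability therefore has to be secured before it can be read
    as a nonnegative integral.\<close>
  have conv: "ennreal (g_conv \<gamma> (\<mu> # \<mu>' # \<mu>s) x t)
      = (\<integral>\<^sup>+s\<in>{0<..}. ennreal (g_kernel \<gamma> \<mu> x s) * ennreal (?f s) \<partial>lborel)" if "0 < x" for x
  proof -
    let ?B = "\<gamma> / (x * Gamma \<mu>) * \<mu> powr \<mu>"
    have "integrable lborel (\<lambda>s. indicator {0<..} s *\<^sub>R (g_kernel \<gamma> \<mu> x s * ?f s))"
    proof (rule Bochner_Integration.integrable_bound)
      show "integrable lborel (\<lambda>s. ?B * (indicator {0<..} s *\<^sub>R ?f s))"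
        using f_int unfolding set_integrable_def by (rule integrable_mult_right)
      show "AE s in lborel. norm (indicator {0<..} s *\<^sub>R (g_kernel \<gamma> \<mu> x s * ?f s))
          \<le> norm (?B * (indicator {0<..} s *\<^sub>R ?f s))"
      proof (intro AE_I2)
        fix s :: real
        have "g_kernel \<gamma> \<mu> x s * ?f s \<le> ?B * ?f s" if "0 < s"
          using that \<open>0 < x\<close> "3.prems" f_nonneg by (intro mult_right_mono g_kernel_bounded) auto
        then show "norm (indicator {0<..} s *\<^sub>R (g_kernel \<gamma> \<mu> x s * ?f s))
            \<le> norm (?B * (indicator {0<..} s *\<^sub>R ?f s))"
          using f_nonneg g_nonneg \<open>0 < x\<close> \<open>0 < \<gamma>\<close> Gamma_real_pos[of \<mu>] "3.prems"
          by (auto simp: indicator_def abs_mult)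
      qed
    qed measurable
    then have "ennreal (g_conv \<gamma> (\<mu> # \<mu>' # \<mu>s) x t)
        = (\<integral>\<^sup>+s. ennreal (indicator {0<..} s *\<^sub>R (g_kernel \<gamma> \<mu> x s * ?f s)) \<partial>lborel)"
      unfolding g_conv.simps mellin_conv_def set_lebesgue_integral_def
      using f_nonneg g_nonneg by (subst nn_integral_eq_integral) auto
    also have "\<dots> = (\<integral>\<^sup>+s\<in>{0<..}. ennreal (g_kernel \<gamma> \<mu> x s) * ennreal (?f s) \<partial>lborel)"
      using f_nonneg g_nonneg by (intro nn_integral_cong) (auto simp: indicator_def ennreal_mult)
    finally show ?thesis .
  qed
  let ?c = "Gamma (\<mu> + p / \<gamma>) / Gamma \<mu>"
  have c: "0 \<le> ?c" using "3.prems" by (auto intro!: divide_nonneg_nonneg less_imp_le Gamma_real_pos)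
  have "(\<integral>\<^sup>+x\<in>{0<..}. ennreal (x powr p * g_conv \<gamma> (\<mu> # \<mu>' # \<mu>s) x t) \<partial>lborel)
      = (\<integral>\<^sup>+x. (\<integral>\<^sup>+s. ennreal (x powr p) * indicator {0<..} x * ennreal (g_kernel \<gamma> \<mu> x s)
            * (ennreal (?f s) * indicator {0<..} s) \<partial>lborel) \<partial>lborel)"
  proof (intro nn_integral_cong)
    fix x :: real
    show "ennreal (x powr p * g_conv \<gamma> (\<mu> # \<mu>' # \<mu>s) x t) * indicator {0<..} x
        = (\<integral>\<^sup>+s. ennreal (x powr p) * indicator {0<..} x * ennreal (g_kernel \<gamma> \<mu> x s)
            * (ennreal (?f s) * indicator {0<..} s) \<partial>lborel)"
    proof (cases "0 < x")
      case True
      then show ?thesis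
        by (simp del: g_conv.simps add: ennreal_mult' conv mult.assoc flip: nn_integral_cmult)
    qed simp
  qed
  also have "\<dots> = (\<integral>\<^sup>+s. (\<integral>\<^sup>+x. ennreal (x powr p) * indicator {0<..} x * ennreal (g_kernel \<gamma> \<mu> x s)
            * (ennreal (?f s) * indicator {0<..} s) \<partial>lborel) \<partial>lborel)"
    by (intro lborel_pair.Fubini') measurable
  also have "\<dots> = (\<integral>\<^sup>+s. ennreal ?c * (ennreal (s powr p * ?f s) * indicator {0<..} s) \<partial>lborel)"
  proof (intro nn_integral_cong)
    fix s :: real
    show "(\<integral>\<^sup>+x. ennreal (x powr p) * indicator {0<..} x * ennreal (g_kernel \<gamma> \<mu> x s)
            * (ennreal (?f s) * indicator {0<..} s) \<partial>lborel)
        = ennreal ?c * (ennreal (s powr p * ?f s) * indicator {0<..} s)"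
    proof (cases "0 < s")
      case True
      have "(\<integral>\<^sup>+x. ennreal (x powr p) * indicator {0<..} x * ennreal (g_kernel \<gamma> \<mu> x s)
              * (ennreal (?f s) * indicator {0<..} s) \<partial>lborel)
          = (\<integral>\<^sup>+x\<in>{0<..}. ennreal (x powr p * g_kernel \<gamma> \<mu> x s) \<partial>lborel) * ennreal (?f s)"
        using True g_nonneg
        by (subst nn_integral_multc) (auto simp: ennreal_mult mult_ac intro!: arg_cong2[where f = "(*)"] nn_integral_cong)
      also have "\<dots> = ennreal (s powr p * ?c) * ennreal (?f s)"
        using True "3.prems" by (subst nn_integral_g_kernel_moment) auto
      finally show ?thesis
        using True c f_nonneg by (simp add: mult_ac flip: ennreal_mult')
    qed simp
  qed
  also have "\<dots> = ennreal ?c * ennreal (t powr p * (\<Prod>\<mu>\<leftarrow>\<mu>' # \<mu>s. Gamma (\<mu> + p / \<gamma>) / Gamma \<mu>))"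
    using "3.prems" by (subst nn_integral_cmult, measurable, subst "3.IH") auto
  also have "\<dots> = ennreal (t powr p * (\<Prod>\<mu>\<leftarrow>\<mu> # \<mu>' # \<mu>s. Gamma (\<mu> + p / \<gamma>) / Gamma \<mu>))"
    by (subst ennreal_mult'[OF c, symmetric]) (simp only: list.map prod_list.Cons mult_ac)
  finally show ?case .
qed simp

subsection \<open>Gamma products and the moment problem\<close>

text \<open>Raising k by one shifts the window of m arguments by one place: the factor at (k+1)/m
  leaves and the one at (k+1)/m + 1 enters. By the functional equation of Gamma their quotient is
  (k+1)/m, and these quotients accumulate to k!/m^k.\<close>

lemma prod_Gamma_arith_shift:
  fixes m k :: nat
  assumes m: "1 \<le> m"
  shows "(\<Prod>j=1..m. Gamma ((real j + real k) / real m))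
           = (\<Prod>j=1..m. Gamma (real j / real m)) * fact k / real m ^ k"
proof (induction k)
  case (Suc k)
  define a where "a = (\<lambda>j. Gamma ((real j + real k) / real m))"
  have pos: "0 < a 1" unfolding a_def using m by (intro Gamma_real_pos) simp
  have step: "a (m + 1) = (real k + 1) / real m * a 1"
  proof -
    have eq: "(real (m + 1) + real k) / real m = (1 + real k) / real m + 1"
      using m by (simp add: field_simps)
    have "(1 + real k) / real m > 0" using m by simp
    then have "(1 + real k) / real m \<notin> \<int>\<^sub>\<le>\<^sub>0" using nonpos_Ints_nonpos by fastforce
    from Gamma_plus1[OF this] show ?thesis
      unfolding a_def eq by (simp add: add.commute)
  qed
  have "(\<Prod>j=1..m. a (Suc j)) * a 1 = (\<Prod>j=1..Suc m. a j)"
    by (subst (2) prod.atLeast_Suc_atMost) (simp_all add: prod.shift_bounds_cl_Suc_ivl del: prod.cl_ivl_Suc)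
  also have "\<dots> = (\<Prod>j=1..m. a j) * a (m + 1)" by simp
  also have "\<dots> = (\<Prod>j=1..m. a j) * ((real k + 1) / real m) * a 1" unfolding step by simp
  finally have "(\<Prod>j=1..m. a (Suc j)) = (\<Prod>j=1..m. a j) * ((real k + 1) / real m)"
    using pos by (metis mult_right_cancel less_irrefl)
  moreover have "a (Suc j) = Gamma ((real j + real (Suc k)) / real m)" for j
    by (simp add: a_def add_ac)
  ultimately have "(\<Prod>j=1..m. Gamma ((real j + real (Suc k)) / real m))
      = (\<Prod>j=1..m. a j) * ((real k + 1) / real m)" by simp
  then show ?case unfolding a_def Suc.IH by (simp add: algebra_simps)
qed simp

text \<open>Take m = n+1 in the shifted product. Its last factor, j = n+1, is Gamma(1 + k/m) on one
  side and Gamma(1) on the other; splitting it off leaves the n factors that occur in the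
  convolution.\<close>

lemma prod_Gamma_ratio:
  fixes n k :: nat
  shows "real (n + 1) ^ k *
           (\<Prod>j=1..n. Gamma (real j / real (n + 1) + real k / real (n + 1)) / Gamma (real j / real (n + 1)))
           = fact k / Gamma (1 + real k / real (n + 1))"
proof -
  define m where "m = real (n + 1)"
  define Y where "Y = (\<Prod>j=1..n. Gamma ((real j + real k) / m))"
  define P where "P = (\<Prod>j=1..n. Gamma (real j / m))"
  define G where "G = Gamma (1 + real k / m)"
  have m: "0 < m" by (simp add: m_def)
  have P: "0 < P" unfolding P_def using m by (intro prod_pos ballI Gamma_real_pos) auto
  have G: "0 < G" unfolding G_def using m by (intro Gamma_real_pos add_pos_nonneg) auto
  have split: "(\<Prod>j=1..n + 1. f j) = (\<Prod>j=1..n. f j) * f (n + 1)" for f :: "nat \<Rightarrow> real" by simp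
  have "(real (n + 1) + real k) / m = 1 + real k / m" "real (n + 1) / m = 1"
    using m by (auto simp: m_def add_divide_distrib)
  then have "Y * G = P * fact k / m ^ k"
    using prod_Gamma_arith_shift[of "n + 1" k, folded m_def] unfolding split
    by (simp only: Y_def G_def P_def Gamma_1 mult_1_right)
  then have "m ^ k * (Y / P) = fact k / G" using m P G by (simp add: field_simps)
  then show ?thesis
    by (simp only: Y_def P_def G_def m_def prod_dividef add_divide_distrib)
qed

text \<open>With S = R+1, the sequence \<open>b\<close> satisfies b(k+m) = b(k) (1 + k/m) / S^m, so
  a step of length m does not decrease it once k is at least m S^m. Hence \<open>b\<close> is
  bounded below by its minimum \<open>c\<close> over an initial segment, and the series is dominated
  by the geometric series of ratio R/S divided by c.\<close>

lemma summable_power_div_Gamma: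
  fixes m :: nat and R :: real
  assumes m: "1 \<le> m" and R: "0 < R"
  shows "summable (\<lambda>k. R ^ k / Gamma (1 + real k / real m))"
proof -
  define S where "S = R + 1"
  define b where "b = (\<lambda>k::nat. Gamma (1 + real k / real m) / S ^ k)"
  \<comment> \<open>The extra summand m ensures that k > N still gives k - m at least m S^m, so the
    recursion can be applied at k - m.\<close>
  define N where "N = nat \<lceil>real m * S ^ m\<rceil> + m"
  define c where "c = Min (b ` {..N})"
  have S: "S > 1" using R by (simp add: S_def)
  have Gpos: "Gamma (1 + real k / real m) > 0" for k
    by (intro Gamma_real_pos) (simp add: add_pos_nonneg)
  have b_pos: "b k > 0" for k using Gpos S by (simp add: b_def)
  have c: "c > 0" unfolding c_def using b_pos by (subst Min_gr_iff) auto
  have b_shift: "b (k + m) = b k * ((1 + real k / real m) / S ^ m)" for k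
  proof -
    have "1 + real k / real m > 0" by (simp add: add_pos_nonneg)
    then have "1 + real k / real m \<notin> \<int>\<^sub>\<le>\<^sub>0" using nonpos_Ints_nonpos by fastforce
    from Gamma_plus1[OF this] show ?thesis
      using m by (simp add: b_def add_divide_distrib[of _ _ "real m"] power_add add_ac)
  qed
  have b_lower: "c \<le> b k" for k
  proof (induction k rule: less_induct)
    case (less k)
    show ?case
    proof (cases "k \<le> N")
      case True
      then show ?thesis unfolding c_def by (intro Min_le) auto
    next
      case False
      then have km: "m \<le> k" "k - m < k" using m by (auto simp: N_def)
      have "real m * S ^ m \<le> real (k - m)"
        using False km by (simp add: N_def) linarith
      then have "S ^ m \<le> real (k - m) / real m" using m by (simp add: field_simps)
      then have "1 \<le> (1 + real (k - m) / real m) / S ^ m" using S by (simp add: field_simps)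
      then have "b (k - m) * 1 \<le> b (k - m + m)"
        unfolding b_shift using b_pos by (intro mult_left_mono) (auto intro: less_imp_le)
      with less.IH[OF km(2)] km(1) show ?thesis by simp
    qed
  qed
  have "summable (\<lambda>k. (R / S) ^ k / c)"
    using R S by (intro summable_divide summable_geometric) (auto simp: S_def)
  moreover have "norm (R ^ k / Gamma (1 + real k / real m)) \<le> (R / S) ^ k / c" for k
  proof -
    have "c * S ^ k \<le> Gamma (1 + real k / real m)"
      using b_lower[of k] S by (simp add: b_def field_simps)
    then have "R ^ k / Gamma (1 + real k / real m) \<le> R ^ k / (c * S ^ k)"
      using R S c Gpos by (intro divide_left_mono mult_pos_pos) auto
    then show ?thesis using R Gpos[of k] by (simp add: power_divide mult.commute less_imp_le)
  qed
  ultimately show ?thesis by (rule summable_comparison_test'[of _ 0]) 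
qed

text \<open>The exponential series is integrated term by term. On the half-line absolute moments are
  plain moments, so the sum of the L1 norms of the terms is the assumed summable series at R =
  |t|.\<close>

lemma char_moment_series:
  fixes M :: "real measure" and a :: "nat \<Rightarrow> real"
  assumes M: "real_distribution M"
    and nonneg: "AE x in M. 0 \<le> x"
    and a: "\<And>k. 0 \<le> a k" "\<And>k. (\<integral>\<^sup>+x. ennreal (x ^ k) \<partial>M) = ennreal (a k)"
    and sum: "\<And>R. 0 < R \<Longrightarrow> summable (\<lambda>k. a k * R ^ k / fact k)"
  shows "(\<lambda>k. (\<i> * of_real t) ^ k / fact k * of_real (a k)) sums char M t"
proof -
  interpret real_distribution M by fact
  define f where "f = (\<lambda>k x. (\<i> * of_real t) ^ k / fact k * complex_of_real (x ^ k))"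
  have mom: "has_bochner_integral M (\<lambda>x. x ^ k) (a k)" for k
    using nonneg a by (intro has_bochner_integral_nn_integral) auto
  have int: "integrable M (f k)" for k
    unfolding f_def using mom[of k] by (intro integrable_mult_right integrable_of_real) (simp add: has_bochner_integral_iff)
  have exp: "(\<lambda>k. f k x) sums iexp (t * x)" for x
    using exp_converges[of "\<i> * of_real (t * x)"]
    by (simp add: f_def scaleR_conv_of_real power_mult_distrib field_simps)
  have norm_f: "norm (f k x) = \<bar>t\<bar> ^ k / fact k * \<bar>x\<bar> ^ k" for k x
    by (simp add: f_def norm_mult norm_divide norm_power)
  have "(\<lambda>k. integral\<^sup>L M (f k)) sums (\<integral>x. (\<Sum>k. f k x) \<partial>M)"
  proof (rule sums_integral[OF int])
    show "AE x in M. summable (\<lambda>k. norm (f k x))"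
    proof (intro AE_I2)
      fix x
      have "summable (\<lambda>k. (\<bar>t\<bar> * \<bar>x\<bar>) ^ k /\<^sub>R fact k)" using exp_converges sums_summable by blast
      then show "summable (\<lambda>k. norm (f k x))" by (simp add: norm_f power_mult_distrib field_simps)
    qed
    have "(\<integral>x. norm (f k x) \<partial>M) = \<bar>t\<bar> ^ k / fact k * a k" for k
    proof -
      have "(\<integral>x. norm (f k x) \<partial>M) = (\<integral>x. \<bar>t\<bar> ^ k / fact k * x ^ k \<partial>M)"
        unfolding norm_f
      proof (rule integral_cong_AE)
        show "AE x in M. \<bar>t\<bar> ^ k / fact k * \<bar>x\<bar> ^ k = \<bar>t\<bar> ^ k / fact k * x ^ k"
          using nonneg by eventually_elim simp
      qed auto
      also have "\<dots> = \<bar>t\<bar> ^ k / fact k * a k"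
        using mom[of k] by (simp add: has_bochner_integral_iff)
      finally show ?thesis .
    qed
    moreover have "summable (\<lambda>k. \<bar>t\<bar> ^ k / fact k * a k)"
    proof (rule summable_comparison_test'[of _ 0])
      \<comment> \<open>The hypothesis asks for R > 0, and t may be 0; hence R = |t| + 1.\<close>
      show "summable (\<lambda>k. a k * (\<bar>t\<bar> + 1) ^ k / fact k)" by (intro sum) auto
      show "norm (\<bar>t\<bar> ^ k / fact k * a k) \<le> a k * (\<bar>t\<bar> + 1) ^ k / fact k" for k
        using a(1)[of k] by (auto simp: abs_mult mult.commute intro!: divide_right_mono mult_left_mono power_mono)
    qed
    ultimately show "summable (\<lambda>k. \<integral>x. norm (f k x) \<partial>M)" by simp
  qed
  moreover have "integral\<^sup>L M (f k) = (\<i> * of_real t) ^ k / fact k * of_real (a k)" for k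
    unfolding f_def using mom[of k] by (simp add: has_bochner_integral_iff del: of_real_power)
  moreover have "(\<integral>x. (\<Sum>k. f k x) \<partial>M) = char M t"
    unfolding char_def using exp by (intro Bochner_Integration.integral_cong) (auto simp: sums_unique[symmetric])
  ultimately show ?thesis by simp
qed

text \<open>Determinacy of the Stieltjes moment problem under a growth condition: both
  characteristic functions are the sum of the same power series.\<close>

lemma real_distribution_eq_if_moments_eq:
  fixes M N :: "real measure" and a :: "nat \<Rightarrow> real"
  assumes "real_distribution M" "real_distribution N"
    and "AE x in M. 0 \<le> x" "AE x in N. 0 \<le> x"
    and "\<And>k. 0 \<le> a k"
    and "\<And>k. (\<integral>\<^sup>+x. ennreal (x ^ k) \<partial>M) = ennreal (a k)"
    and "\<And>k. (\<integral>\<^sup>+x. ennreal (x ^ k) \<partial>N) = ennreal (a k)"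
    and "\<And>R. 0 < R \<Longrightarrow> summable (\<lambda>k. a k * R ^ k / fact k)"
  shows "M = N"
proof (rule Levy_uniqueness)
  show "char M = char N"
    using char_moment_series[of M a] char_moment_series[of N a] assms
    by (intro ext) (metis (no_types, lifting) sums_unique2)
qed (use assms in auto)

subsection \<open>Smoothness of Laplace integrals and of distribution functions\<close>

lemma mult_exp_minus_le_one:
  fixes v :: real
  shows "v * exp (- v) \<le> 1"
proof -
  have "v \<le> exp v" using exp_ge_add_one_self[of v] by linarith
  then show ?thesis by (simp add: exp_minus field_simps)
qed

text \<open>A Lipschitz estimate from 1 - exp(-v) \<le> v. Placing the exponential at a common lower
  bound u makes it uniform, so that it can dominate difference quotients.\<close>

lemma abs_exp_minus_diff_le:
  fixes y z w u :: real
  assumes "0 \<le> w" "u \<le> y" "u \<le> z"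
  shows "\<bar>exp (- (y * w)) - exp (- (z * w))\<bar> \<le> \<bar>y - z\<bar> * (w * exp (- (u * w)))"
  using assms(2,3)
proof (induction y z rule: linorder_wlog)
  case (le y z)
  have "exp (- (y * w)) - exp (- (z * w)) = exp (- (y * w)) * (1 - exp (- ((z - y) * w)))"
    by (simp add: algebra_simps flip: exp_add)
  also have "\<dots> \<le> exp (- (u * w)) * ((z - y) * w)"
  proof (intro mult_mono)
    show "exp (- (y * w)) \<le> exp (- (u * w))" using le assms by (simp add: mult_right_mono)
    show "1 - exp (- ((z - y) * w)) \<le> (z - y) * w"
      using exp_ge_add_one_self[of "- ((z - y) * w)"] by linarith
  qed (use le assms in auto)
  finally have "exp (- (y * w)) - exp (- (z * w)) \<le> (z - y) * (w * exp (- (u * w)))"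
    by (simp add: mult_ac)
  moreover have "exp (- (z * w)) \<le> exp (- (y * w))" using le assms by (simp add: mult_right_mono)
  ultimately show ?case using le by simp
next
  case (sym y z)
  then show ?case by (simp add: abs_minus_commute)
qed

text \<open>Laplace integrals over an abstract measure, so that one development covers both a point
  mass (a single kernel) and Lebesgue measure (a genuine convolution). Only integrability of
  \<open>a\<close> is assumed; the factor \<open>w\<close> produced by differentiation is absorbed
  by the exponential.\<close>

locale laplace_integral =
  fixes N :: "'b measure" and a w :: "'b \<Rightarrow> real"
  assumes a_int [simp]: "integrable N a" and a_nonneg: "\<And>s. 0 \<le> a s"
    and w_meas [measurable]: "w \<in> borel_measurable N" and w_nonneg: "\<And>s. 0 \<le> w s"
begin

definition "\<phi> z = (\<integral>s. a s * exp (- (z * w s)) \<partial>N)"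
definition "\<phi>' z = - (\<integral>s. a s * (w s * exp (- (z * w s))) \<partial>N)"

lemma a_meas [measurable]: "a \<in> borel_measurable N"
  using a_int by (rule borel_measurable_integrable)

lemma abs_integrand_le: "0 \<le> z \<Longrightarrow> \<bar>a s * exp (- (z * w s))\<bar> \<le> a s"
  using a_nonneg[of s] w_nonneg[of s] by (simp add: abs_mult mult_left_le)

lemma integrable_\<phi>: "0 \<le> z \<Longrightarrow> integrable N (\<lambda>s. a s * exp (- (z * w s)))"
  by (rule Bochner_Integration.integrable_bound[OF a_int]) (use abs_integrand_le a_nonneg in auto)

text \<open>This is v exp(-v) \<le> 1 at v = u w. Being uniform in z \<ge> u, it supplies the
  dominating function both for continuity of \<open>\<phi>'\<close> and for differentiation under
  the integral.\<close>

lemma abs_integrand'_le: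
  assumes "0 < u" "u \<le> z"
  shows "\<bar>a s * (w s * exp (- (z * w s)))\<bar> \<le> a s / u"
proof -
  have "u * w s * exp (- (z * w s)) \<le> u * w s * exp (- (u * w s))"
    using assms w_nonneg[of s] by (intro mult_left_mono) (auto intro: mult_right_mono)
  also have "\<dots> \<le> 1" by (rule mult_exp_minus_le_one)
  finally have "w s * exp (- (z * w s)) \<le> 1 / u" using assms by (simp add: field_simps)
  from mult_left_mono[OF this a_nonneg[of s]] show ?thesis
    using a_nonneg[of s] w_nonneg[of s] by (simp add: abs_mult)
qed

lemma \<phi>_nonneg: "0 \<le> \<phi> z"
  unfolding \<phi>_def using a_nonneg by (intro Bochner_Integration.integral_nonneg) auto

lemma \<phi>_le: "0 \<le> z \<Longrightarrow> \<phi> z \<le> integral\<^sup>L N a"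
  unfolding \<phi>_def using abs_integrand_le
  by (intro Bochner_Integration.integral_mono integrable_\<phi>) (auto intro: order_trans[OF abs_ge_self])

lemma abs_\<phi>'_le:
  assumes "0 < z"
  shows "\<bar>z * \<phi>' z\<bar> \<le> integral\<^sup>L N a"
proof -
  have "\<bar>\<phi>' z\<bar> \<le> (\<integral>s. a s / z \<partial>N)"
    unfolding \<phi>'_def abs_minus_cancel
    using abs_integrand'_le[OF assms order_refl] assms a_nonneg
    by (intro order_trans[OF integral_abs_bound] integral_mono') auto
  then show ?thesis using assms by (simp add: abs_mult field_simps)
qed

lemma isCont_\<phi>':
  assumes "0 < z"
  shows "isCont \<phi>' z"
proof -
  \<comment> \<open>The open half-line beyond z/2 is a neighbourhood of z bounded away from 0, where
    \<open>a s / (z / 2)\<close> dominates.\<close>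
  have "continuous (at z within {z / 2<..}) \<phi>'"
  proof (subst continuous_within_sequentially, intro allI impI, elim conjE)
    fix X :: "nat \<Rightarrow> real" assume X: "\<forall>n. X n \<in> {z / 2<..}" "X \<longlonglongrightarrow> z"
    show "(\<phi>' \<circ> X) \<longlonglongrightarrow> \<phi>' z"
      unfolding \<phi>'_def comp_def
    proof (intro tendsto_minus integral_dominated_convergence[where w = "\<lambda>s. a s / (z / 2)"] AE_I2)
      show "norm (a s * (w s * exp (- (X n * w s)))) \<le> a s / (z / 2)" for s n
        using abs_integrand'_le[of "z / 2" "X n" s] assms X(1)[rule_format, of n] by simp
    qed (use X(2) in \<open>auto intro!: tendsto_intros\<close>)
  qed
  then show ?thesis using assms by (simp add: at_within_open[of z "{z / 2<..}"])
qed

lemma DERIV_\<phi>: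
  assumes "0 < z"
  shows "(\<phi> has_real_derivative \<phi>' z) (at z)"
proof -
  have "(\<phi> has_real_derivative \<phi>' z) (at z within {z / 2<..})"
    unfolding has_field_derivative_iff
  proof (subst tendsto_at_iff_sequentially, intro allI impI)
    fix X :: "nat \<Rightarrow> real" assume X: "\<forall>i. X i \<in> {z / 2<..} - {z}" "X \<longlonglongrightarrow> z"
    have Xi: "z / 2 < X i" "X i \<noteq> z" for i using X(1) by auto
    let ?q = "\<lambda>i s. (exp (- (X i * w s)) - exp (- (z * w s))) / (X i - z)"
    have "(\<lambda>i. \<integral>s. a s * ?q i s \<partial>N) \<longlonglongrightarrow> (\<integral>s. a s * (- w s * exp (- (z * w s))) \<partial>N)"
    proof (intro integral_dominated_convergence[where w = "\<lambda>s. a s / (z / 2)"] AE_I2)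
      fix s
      have "((\<lambda>y. exp (- (y * w s))) has_real_derivative - w s * exp (- (z * w s))) (at z)"
        by (auto intro!: derivative_eq_intros)
      then have "((\<lambda>y. (exp (- (y * w s)) - exp (- (z * w s))) / (y - z)) \<longlongrightarrow> - w s * exp (- (z * w s))) (at z)"
        unfolding has_field_derivative_iff .
      then have "(\<lambda>i. ?q i s) \<longlonglongrightarrow> - w s * exp (- (z * w s))"
        using X Xi by (auto simp: tendsto_at_iff_sequentially comp_def)
      then show "(\<lambda>i. a s * ?q i s) \<longlonglongrightarrow> a s * (- w s * exp (- (z * w s)))"
        by (intro tendsto_mult tendsto_const)
    next
      fix i s
      have "\<bar>exp (- (X i * w s)) - exp (- (z * w s))\<bar> \<le> \<bar>X i - z\<bar> * (w s * exp (- (z / 2 * w s)))"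
        using Xi[of i] assms w_nonneg by (intro abs_exp_minus_diff_le) auto
      then have "\<bar>?q i s\<bar> \<le> w s * exp (- (z / 2 * w s))"
        using Xi[of i] by (simp add: field_simps)
      then have "\<bar>a s * ?q i s\<bar> \<le> a s * (w s * exp (- (z / 2 * w s)))"
        unfolding abs_mult abs_of_nonneg[OF a_nonneg] by (intro mult_left_mono a_nonneg)
      also have "\<dots> \<le> a s / (z / 2)"
        using abs_integrand'_le[of "z / 2" "z / 2" s] assms by simp
      finally show "norm (a s * ?q i s) \<le> a s / (z / 2)" by simp
    qed auto
    also have "(\<lambda>i. \<integral>s. a s * ?q i s \<partial>N) = (\<lambda>y. (\<phi> y - \<phi> z) / (y - z)) \<circ> X"
    proof (rule ext)
      fix i
      have "0 \<le> X i" using Xi[of i] assms by linarith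
      then have "\<phi> (X i) - \<phi> z = (\<integral>s. a s * exp (- (X i * w s)) - a s * exp (- (z * w s)) \<partial>N)"
        unfolding \<phi>_def using assms by (intro Bochner_Integration.integral_diff[symmetric] integrable_\<phi>) auto
      also have "\<dots> / (X i - z) = (\<integral>s. a s * ?q i s \<partial>N)"
        by (subst integral_divide_zero[symmetric]) (simp add: algebra_simps diff_divide_distrib)
      finally show "(\<integral>s. a s * ?q i s \<partial>N) = ((\<lambda>y. (\<phi> y - \<phi> z) / (y - z)) \<circ> X) i"
        by (simp only: comp_def)
    qed
    also have "(\<integral>s. a s * (- w s * exp (- (z * w s))) \<partial>N) = \<phi>' z"
      by (simp add: \<phi>'_def)
    finally show "((\<lambda>y. (\<phi> y - \<phi> z) / (y - z)) \<circ> X) \<longlonglongrightarrow> \<phi>' z" .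
  qed
  then show ?thesis using assms by (simp add: at_within_open[of z "{z / 2<..}"])
qed

end

text \<open>On [u/2, u+1], which stays away from 0, the distribution function is a constant plus the
  integral of a continuous function, so the fundamental theorem applies. Nothing is asked of the
  behaviour of f at 0.\<close>

lemma DERIV_cdf_density:
  fixes f :: "real \<Rightarrow> real"
  assumes P: "real_distribution P" "P = density lborel (\<lambda>x. ennreal (f x))"
    and f [measurable]: "f \<in> borel_measurable borel" and nonneg: "\<And>x. 0 \<le> f x"
    and cont: "continuous_on {0<..} f" and u: "0 < u"
  shows "(cdf P has_real_derivative f u) (at u)"
proof -
  interpret real_distribution P by fact
  let ?a = "u / 2" and ?b = "u + 1"
  have cont': "continuous_on {?a..x} f" for x
    using u by (intro continuous_on_subset[OF cont]) auto
  have eq: "cdf P x = cdf P ?a + integral {?a..x} f" if x: "x \<in> {?a..?b}" for x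
  proof -
    have "emeasure P {?a<..x} = (\<integral>\<^sup>+s. ennreal (f s) * indicator {?a<..x} s \<partial>lborel)"
      unfolding P(2) by (intro emeasure_density) auto
    also have "\<dots> = (\<integral>\<^sup>+s. ennreal (f s) * indicator {?a..x} s \<partial>lborel)"
      by (intro nn_integral_cong_AE eventually_mono[OF AE_lborel_singleton[of ?a]]) (auto simp: indicator_def)
    also have "\<dots> = ennreal (integral {?a..x} f)"
      using nonneg cont'
      by (intro nn_integral_has_integral_lebesgue' integrable_integral integrable_continuous_real) auto
    finally have "measure P {?a<..x} = integral {?a..x} f"
      using nonneg cont' by (simp add: measure_def integral_nonneg integrable_continuous_real)
    moreover have "measure P {?a<..x} = cdf P x - cdf P ?a"
      using x cdf_diff_eq[of ?a x] by (cases "?a = x") auto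
    ultimately show ?thesis by simp
  qed
  have "((\<lambda>x. integral {?a..x} f) has_real_derivative f u) (at u within {?a..?b})"
    using u by (intro integral_has_real_derivative cont') auto
  then have "((\<lambda>x. cdf P ?a + integral {?a..x} f) has_real_derivative f u) (at u within {?a..?b})"
    by (auto intro!: derivative_eq_intros)
  then have "(cdf P has_real_derivative f u) (at u within {?a..?b})"
    by (rule has_field_derivative_transform_within[OF _ zero_less_one]) (use u in \<open>auto intro: eq[symmetric]\<close>)
  then show ?thesis using u by (simp add: at_within_Icc_at)
qed

subsection \<open>The first kernel as a Laplace integrand\<close>

text \<open>For the first parameter 1/\<gamma> the power x^(\<gamma> \<mu> - 1) is constant, so x
  enters only through exp(-x^\<gamma> s^(-\<gamma>)). What remains is a Laplace transform at z =
  x^\<gamma> with weight s^(-1) times the rest of the convolution.\<close>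

lemma g_conv_laplace_integral:
  assumes pos: "0 < \<gamma>" "0 < t" and \<mu>s: "\<And>\<mu>. \<mu> \<in> set \<mu>s \<Longrightarrow> 1 / \<gamma> < \<mu>"
  shows "\<exists>(N :: real measure) a w. laplace_integral N a w \<and>
           (\<forall>x>0. g_conv \<gamma> (1 / \<gamma> # \<mu>s) x t = laplace_integral.\<phi> N a w (x powr \<gamma>))"
proof (cases \<mu>s)
  case Nil
  define a where "a = (\<lambda>_::real. \<gamma> / (t * Gamma (1 / \<gamma>)))"
  define w where "w = (\<lambda>_::real. t powr - \<gamma>)"
  \<comment> \<open>With one kernel there is no integration; any point mass will do, since
    \<open>a\<close> and \<open>w\<close> are constant.\<close>
  have lap: "laplace_integral (return borel 0) a w"
  proof
    interpret prob_space "return borel (0::real)" by (rule prob_space_return) simp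
    show "integrable (return borel 0) a" unfolding a_def by simp
  qed (use pos in \<open>auto simp: a_def w_def\<close>)
  moreover have "g_conv \<gamma> (1 / \<gamma> # \<mu>s) x t = laplace_integral.\<phi> (return borel 0) a w (x powr \<gamma>)"
    if "0 < x" for x
    unfolding laplace_integral.\<phi>_def[OF lap] using that pos
    by (simp add: Nil integral_return measure_return a_def w_def g_kernel_def powr_minus_divide)
  ultimately show ?thesis by blast
next
  case (Cons \<mu> \<mu>s')
  define f where "f = (\<lambda>s. g_conv \<gamma> \<mu>s s t)"
  define a where "a = (\<lambda>s::real. indicator {0<..} s * (\<gamma> / Gamma (1 / \<gamma>) * (s powr - 1 * f s)))"
  define w where "w = (\<lambda>s::real. s powr - \<gamma>)"
  have \<mu>s_pos: "0 < \<mu>" if "\<mu> \<in> set \<mu>s" for \<mu>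
    using \<mu>s[OF that] pos by (meson order.strict_trans zero_less_divide_1_iff)
  have f_nonneg: "0 \<le> f s" for s unfolding f_def using \<mu>s_pos by (rule g_conv_nonneg)
  have f_meas [measurable]: "f \<in> borel_measurable borel" unfolding f_def by measurable
  have c: "0 < \<gamma> / Gamma (1 / \<gamma>)" using pos by simp
  have lap: "laplace_integral lborel a w"
  proof
    \<comment> \<open>The weight is integrable because the moment of order -1 is finite; this is
      where \<mu> > 1/\<gamma> for the remaining parameters enters.\<close>
    have "(\<integral>\<^sup>+s\<in>{0<..}. ennreal (s powr - 1 * f s) \<partial>lborel) < \<infinity>"
      unfolding f_def using pos \<mu>s \<mu>s_pos Cons by (subst nn_integral_g_conv_moment) auto
    also have "(\<integral>\<^sup>+s\<in>{0<..}. ennreal (s powr - 1 * f s) \<partial>lborel)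
        = (\<integral>\<^sup>+s. ennreal (indicator {0<..} s * (s powr - 1 * f s)) \<partial>lborel)"
      by (intro nn_integral_cong) (auto simp: indicator_def)
    finally have "integrable lborel (\<lambda>s. indicator {0<..} s * (s powr - 1 * f s))"
      using f_nonneg by (intro integrableI_nonneg) auto
    then have "integrable lborel (\<lambda>s. \<gamma> / Gamma (1 / \<gamma>) * (indicator {0<..} s * (s powr - 1 * f s)))"
      by (rule integrable_mult_right)
    then show "integrable lborel a" by (simp add: a_def mult_ac)
    show "0 \<le> a s" for s
      unfolding a_def using c f_nonneg by (intro mult_nonneg_nonneg) (auto intro: less_imp_le)
  qed (auto simp: w_def)
  moreover have "g_conv \<gamma> (1 / \<gamma> # \<mu>s) x t = laplace_integral.\<phi> lborel a w (x powr \<gamma>)"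
    if "0 < x" for x
    unfolding Cons g_conv.simps mellin_conv_def set_lebesgue_integral_def laplace_integral.\<phi>_def[OF lap]
    using that pos Cons
    by (intro Bochner_Integration.integral_cong)
       (auto simp: indicator_def a_def w_def f_def g_kernel_def powr_minus_divide mult_ac)
  ultimately show ?thesis by blast
qed

text \<open>Chain rule through z = x^\<gamma>. Since x K'(x) = \<gamma> z \<phi>'(z), the bound on z
  \<phi>'(z) becomes a bound on x K'(x), uniform in x.\<close>

lemma g_conv_smooth:
  assumes pos: "0 < \<gamma>" "0 < t" and \<mu>s: "\<And>\<mu>. \<mu> \<in> set \<mu>s \<Longrightarrow> 1 / \<gamma> < \<mu>"
  defines "K \<equiv> \<lambda>x. g_conv \<gamma> (1 / \<gamma> # \<mu>s) x t"
  obtains K' C where "\<And>x. 0 < x \<Longrightarrow> (K has_real_derivative K' x) (at x)"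
    and "\<And>x. 0 < x \<Longrightarrow> isCont K' x"
    and "\<And>x. 0 < x \<Longrightarrow> \<bar>K x\<bar> \<le> C" and "\<And>x. 0 < x \<Longrightarrow> \<bar>x * K' x\<bar> \<le> \<gamma> * C"
proof -
  obtain N :: "real measure" and a w where lap: "laplace_integral N a w"
    and K: "\<And>x. 0 < x \<Longrightarrow> K x = laplace_integral.\<phi> N a w (x powr \<gamma>)"
    using g_conv_laplace_integral[OF pos \<mu>s] unfolding K_def by blast
  interpret laplace_integral N a w by (rule lap)
  define K' where "K' = (\<lambda>x. \<phi>' (x powr \<gamma>) * (\<gamma> * x powr (\<gamma> - 1)))"
  show ?thesis
  proof
    fix x :: real assume x: "0 < x"
    then have z: "0 < x powr \<gamma>" by simp
    have "((\<lambda>x. x powr \<gamma>) has_real_derivative \<gamma> * x powr (\<gamma> - 1)) (at x)"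
      using x by (auto intro!: derivative_eq_intros)
    from DERIV_chain2[OF DERIV_\<phi>[OF z] this]
    have "((\<lambda>x. \<phi> (x powr \<gamma>)) has_real_derivative K' x) (at x)" by (simp add: K'_def)
    then show "(K has_real_derivative K' x) (at x)"
      by (rule has_field_derivative_transform_within_open[of _ _ _ "{0<..}"]) (use x K in auto)
    show "isCont K' x"
      unfolding K'_def using x by (intro continuous_intros isCont_o2[where g = \<phi>' and f = "\<lambda>x. x powr \<gamma>"] isCont_\<phi>'[OF z]) auto
    show "\<bar>K x\<bar> \<le> integral\<^sup>L N a" using K[OF x] \<phi>_nonneg \<phi>_le[of "x powr \<gamma>"] by simp
    have "x * K' x = \<gamma> * (x powr \<gamma> * \<phi>' (x powr \<gamma>))" using x by (simp add: K'_def powr_diff)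
    then have "\<bar>x * K' x\<bar> = \<gamma> * \<bar>x powr \<gamma> * \<phi>' (x powr \<gamma>)\<bar>" using pos by (simp only: abs_mult[of \<gamma>])
    also have "\<dots> \<le> \<gamma> * integral\<^sup>L N a"
      using pos abs_\<phi>'_le[OF z] by (intro mult_left_mono) auto
    finally show "\<bar>x * K' x\<bar> \<le> \<gamma> * integral\<^sup>L N a" .
  qed
qed

subsection \<open>Negative moments of the stable subordinator\<close>

context stable_subordinator
begin

lemma AE_nonneg:
  assumes "0 \<le> x"
  shows "AE \<omega> in M. 0 \<le> \<tau> x \<omega>"
  using start_zero mono_paths
proof eventually_elim
  case (elim \<omega>)
  then show ?case using assms mono_onD[of "{0..}" "\<lambda>t. \<tau> t \<omega>" 0 x] by simp
qed

lemma nn_integral_exp: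
  assumes "0 < x" "0 < r"
  shows "(\<integral>\<^sup>+\<omega>. ennreal (exp (- (r * \<tau> x \<omega>))) \<partial>M) = ennreal (exp (- (x * r powr \<nu>)))"
proof -
  have [measurable]: "\<tau> x \<in> borel_measurable M" using measurable_X assms by simp
  have "integrable M (\<lambda>\<omega>. exp (- (r * \<tau> x \<omega>)))"
    using AE_nonneg[of x] assms by (intro integrable_const_bound[where B = 1]) auto
  then show ?thesis using laplace[OF assms] by (subst nn_integral_eq_integral) auto
qed

text \<open>Gamma(p) \<tau>^(-p) is the integral of r^(p-1) exp(-r \<tau>) over r > 0. After Tonelli
  the inner expectation is the known Laplace transform, and the outer integral is
  \<open>nn_integral_gamma_power\<close> with exponent \<nu>.\<close>

lemma nn_integral_negative_moment:
  assumes "0 < x" "0 < p" and pos: "AE \<omega> in M. 0 < \<tau> x \<omega>"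
  shows "(\<integral>\<^sup>+\<omega>. ennreal (Gamma p * \<tau> x \<omega> powr - p) \<partial>M)
           = ennreal (Gamma (p / \<nu>) / (\<nu> * x powr (p / \<nu>)))"
proof -
  have [measurable]: "\<tau> x \<in> borel_measurable M" using measurable_X assms by simp
  interpret pair_sigma_finite M lborel
    by (intro pair_sigma_finite.intro sigma_finite_measure_axioms sigma_finite_lborel)
  have "(\<integral>\<^sup>+\<omega>. ennreal (Gamma p * \<tau> x \<omega> powr - p) \<partial>M)
      = (\<integral>\<^sup>+\<omega>. (\<integral>\<^sup>+r. ennreal (r powr (p - 1) * exp (- (\<tau> x \<omega> * r powr 1))) * indicator {0<..} r \<partial>lborel) \<partial>M)"
    using pos
  proof (intro nn_integral_cong_AE, eventually_elim)
    case (elim \<omega>)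
    then show ?case
      using nn_integral_gamma_power[of p "\<tau> x \<omega>" 1] assms by (simp add: powr_minus_divide)
  qed
  also have "\<dots> = (\<integral>\<^sup>+r. (\<integral>\<^sup>+\<omega>. ennreal (r powr (p - 1) * exp (- (\<tau> x \<omega> * r powr 1))) * indicator {0<..} r \<partial>M) \<partial>lborel)"
    by (intro Fubini'[symmetric]) measurable
  also have "\<dots> = (\<integral>\<^sup>+r\<in>{0<..}. ennreal (r powr (p - 1) * exp (- (x * r powr \<nu>))) \<partial>lborel)"
  proof (intro nn_integral_cong)
    fix r :: real
    show "(\<integral>\<^sup>+\<omega>. ennreal (r powr (p - 1) * exp (- (\<tau> x \<omega> * r powr 1))) * indicator {0<..} r \<partial>M)
        = ennreal (r powr (p - 1) * exp (- (x * r powr \<nu>))) * indicator {0<..} r"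
    proof (cases "0 < r")
      case True
      then show ?thesis
        using nn_integral_exp[of x r] assms
        by (simp add: ennreal_mult' nn_integral_cmult mult.commute[of "\<tau> x _"])
    qed simp
  qed
  also have "\<dots> = ennreal (Gamma (p / \<nu>) / (\<nu> * x powr (p / \<nu>)))"
    using assms index by (intro nn_integral_gamma_power)
  finally show ?thesis .
qed

text \<open>The negative moment at p = \<nu> k, simplified by k Gamma(k) = k! and Gamma(1+p) = p
  Gamma(p); the powers of x cancel, so the law does not depend on x. The case k = 0 is separate
  because p must be positive.\<close>

lemma nn_integral_inverse_moment:
  assumes "0 < x" and pos: "AE \<omega> in M. 0 < \<tau> x \<omega>"
  shows "(\<integral>\<^sup>+\<omega>. ennreal ((x * \<tau> x \<omega> powr - \<nu>) ^ k) \<partial>M) = ennreal (fact k / Gamma (1 + \<nu> * real k))"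
proof (cases "k = 0")
  case True
  then show ?thesis by (simp add: emeasure_space_1)
next
  case False
  have [measurable]: "\<tau> x \<in> borel_measurable M" using measurable_X assms by simp
  let ?p = "\<nu> * real k"
  have p: "0 < ?p" "?p / \<nu> = real k" using index False by auto
  have G: "0 < Gamma ?p" using p by simp
  have "?p \<notin> \<int>\<^sub>\<le>\<^sub>0" using p nonpos_Ints_nonpos by fastforce
  from Gamma_plus1[OF this] have G1: "Gamma (1 + ?p) = ?p * Gamma ?p" by (simp add: add.commute)
  have Gk: "Gamma (real k) * real k = fact k"
    using Gamma_fact[of "k - 1", where 'a = real] False fact_reduce[of k, where 'a = real]
    by (simp add: of_nat_diff)
  have "(\<integral>\<^sup>+\<omega>. ennreal ((x * \<tau> x \<omega> powr - \<nu>) ^ k) \<partial>M)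
      = (\<integral>\<^sup>+\<omega>. ennreal (x ^ k / Gamma ?p) * ennreal (Gamma ?p * \<tau> x \<omega> powr - ?p) \<partial>M)"
    using pos
  proof (intro nn_integral_cong_AE, eventually_elim)
    case (elim \<omega>)
    then have "(x * \<tau> x \<omega> powr - \<nu>) ^ k = x ^ k * \<tau> x \<omega> powr - ?p"
      by (simp add: power_mult_distrib powr_realpow[symmetric] powr_powr)
    then show ?case using G assms by (simp flip: ennreal_mult')
  qed
  also have "\<dots> = ennreal (x ^ k / Gamma ?p) * ennreal (Gamma (real k) / (\<nu> * x powr real k))"
    using assms p by (subst nn_integral_cmult) (simp_all add: nn_integral_negative_moment)
  also have "\<dots> = ennreal (x ^ k / Gamma ?p * (Gamma (real k) / (\<nu> * x powr real k)))"
    using G assms by (intro ennreal_mult'[symmetric]) simp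
  also have "x ^ k / Gamma ?p * (Gamma (real k) / (\<nu> * x powr real k)) = fact k / Gamma (1 + ?p)"
    using assms G index False unfolding G1 Gk[symmetric] by (simp add: powr_realpow field_simps)
  finally show ?thesis .
qed

end

subsection \<open>Laws of the subordinator and its inverse\<close>

lemma distr_borel_eq_density:
  assumes "distributed M lborel X f"
  shows "distr M borel X = density lborel f"
proof -
  have "distr M borel X = distr M lborel X" by (rule distr_cong) auto
  then show ?thesis using distributed_distr_eq_density[OF assms] by simp
qed

lemma nn_integral_rescaled_density_atMost:
  fixes K :: "real \<Rightarrow> real"
  assumes c: "0 < c" and K [measurable]: "K \<in> borel_measurable borel"
  shows "(\<integral>\<^sup>+y. ennreal (K (y / c) / c) * indicator {..x} y \<partial>lborel)
           = (\<integral>\<^sup>+y. ennreal (K y) * indicator {..x / c} y \<partial>lborel)"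
proof -
  have "(\<integral>\<^sup>+y. ennreal (K (y / c) / c) * indicator {..x} y \<partial>lborel)
      = ennreal c * (\<integral>\<^sup>+y. ennreal (K y / c) * indicator {..x} (c * y) \<partial>lborel)"
    using c by (subst nn_integral_real_affine[where c = c and t = 0]) auto
  also have "\<dots> = (\<integral>\<^sup>+y. ennreal c * (ennreal (K y / c) * indicator {..x} (c * y)) \<partial>lborel)"
    by (rule nn_integral_cmult[symmetric]) measurable
  also have "\<dots> = (\<integral>\<^sup>+y. ennreal (K y) * indicator {..x / c} y \<partial>lborel)"
    using c by (intro nn_integral_cong) (auto simp: indicator_def field_simps simp flip: ennreal_mult')
  finally show ?thesis .
qed

section \<open>The candidate density \<open>K\<close> and its law \<open>D\<close>\<close>

locale stable_root_subordinator = stable_subordinator M \<tau> \<nu>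
  for M :: "'a measure" and \<tau> \<nu> +
  fixes n :: nat and h :: "real \<Rightarrow> real \<Rightarrow> real" and \<mu>s :: "real list"
  assumes n: "1 \<le> n" and \<nu>: "\<nu> = 1 / real (n + 1)"
    and \<mu>s: "\<mu>s = map (\<lambda>j. real j * \<nu>) [1..<n + 1]"
    and dens: "continuous_density M \<tau> h"
begin

definition "K x = g_conv (real (n + 1)) \<mu>s x (real (n + 1))"

lemma \<mu>s_pos: "\<mu> \<in> set \<mu>s \<Longrightarrow> 0 < \<mu>"
  by (auto simp: \<mu>s \<nu>)

text \<open>Exhibits the first parameter 1/(n+1), the one that makes the Laplace representation
  possible; the others, j \<ge> 2, exceed it strictly.\<close>

lemma \<mu>s_Cons: "\<mu>s = 1 / real (n + 1) # map (\<lambda>j. real j * \<nu>) [2..<n + 1]"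
proof -
  have "[1..<n + 1] = 1 # [2..<n + 1]"
    using n by (simp add: upt_conv_Cons numeral_2_eq_2 del: upt_Suc)
  then show ?thesis by (simp add: \<mu>s \<nu> del: upt_Suc)
qed

lemma K_nonneg: "0 \<le> K x"
  unfolding K_def by (rule g_conv_nonneg) (rule \<mu>s_pos)

lemma K_meas [measurable]: "K \<in> borel_measurable borel"
  unfolding K_def by measurable

lemma K_smooth:
  obtains K' C where "\<And>x. 0 < x \<Longrightarrow> (K has_real_derivative K' x) (at x)"
    and "\<And>x. 0 < x \<Longrightarrow> isCont K' x"
    and "\<And>x. 0 < x \<Longrightarrow> \<bar>K x\<bar> \<le> C" and "\<And>x. 0 < x \<Longrightarrow> \<bar>x * K' x\<bar> \<le> real (n + 1) * C"
proof -
  let ?m = "real (n + 1)" and ?r = "map (\<lambda>j. real j * \<nu>) [2..<n + 1]"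
  have m: "0 < ?m" by simp
  have r: "1 / ?m < \<mu>" if "\<mu> \<in> set ?r" for \<mu>
    using that by (auto simp: \<nu> divide_strict_right_mono)
  show ?thesis
    by (rule g_conv_smooth[where \<mu>s = ?r, OF m m r, folded \<mu>s_Cons K_def]) (assumption, rule that)
qed

lemma K_cont: "continuous_on {0<..} K"
proof -
  obtain K' where "\<And>x. 0 < x \<Longrightarrow> (K has_real_derivative K' x) (at x)" using K_smooth by metis
  then show ?thesis
    by (auto intro!: continuous_at_imp_continuous_on DERIV_isCont)
qed

text \<open>The scale n+1 contributes (n+1)^k, exactly the factor that the Gamma product needs to
  become k! / Gamma(1 + \<nu> k). This accounts for the constant m in \<open>\<psi>\<close>.\<close>

lemma K_moment:
  "(\<integral>\<^sup>+x\<in>{0<..}. ennreal (x ^ k * K x) \<partial>lborel) = ennreal (fact k / Gamma (1 + \<nu> * real k))"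
proof -
  let ?m = "real (n + 1)"
  have "(\<integral>\<^sup>+x\<in>{0<..}. ennreal (x ^ k * K x) \<partial>lborel)
      = (\<integral>\<^sup>+x\<in>{0<..}. ennreal (x powr real k * K x) \<partial>lborel)"
    by (intro nn_integral_cong) (auto simp: indicator_def powr_realpow)
  also have "\<dots> = ennreal (?m powr real k * (\<Prod>\<mu>\<leftarrow>\<mu>s. Gamma (\<mu> + real k / ?m) / Gamma \<mu>))"
    unfolding K_def using \<mu>s_pos by (intro nn_integral_g_conv_moment) (auto simp: \<mu>s_Cons add_pos_nonneg)
  also have "(\<Prod>\<mu>\<leftarrow>\<mu>s. Gamma (\<mu> + real k / ?m) / Gamma \<mu>)
      = (\<Prod>j=1..n. Gamma (real j / ?m + real k / ?m) / Gamma (real j / ?m))"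
    unfolding \<mu>s \<nu> map_map comp_def
    by (subst prod.distinct_set_conv_list[symmetric])
       (simp_all add: atLeastLessThanSuc_atLeastAtMost del: upt_Suc of_nat_add)
  also have "?m powr real k = ?m ^ k" by (simp add: powr_realpow del: of_nat_add)
  also note prod_Gamma_ratio
  finally show ?thesis by (simp add: \<nu>)
qed

text \<open>The convolution is meaningful only for x > 0, so its values elsewhere are cut off. Total
  mass 1 comes later, from the moment of order 0.\<close>

definition "D = density lborel (\<lambda>x. ennreal (if 0 < x then K x else 0))"

lemma D_moment: "(\<integral>\<^sup>+x. ennreal (x ^ k) \<partial>D) = ennreal (fact k / Gamma (1 + \<nu> * real k))"
proof -
  have "(\<integral>\<^sup>+x. ennreal (x ^ k) \<partial>D)
      = (\<integral>\<^sup>+x. ennreal (if 0 < x then K x else 0) * ennreal (x ^ k) \<partial>lborel)"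
    unfolding D_def by (intro nn_integral_density) auto
  also have "\<dots> = (\<integral>\<^sup>+x\<in>{0<..}. ennreal (x ^ k * K x) \<partial>lborel)"
    by (intro nn_integral_cong) (auto simp: indicator_def mult.commute K_nonneg simp flip: ennreal_mult')
  finally show ?thesis by (simp add: K_moment)
qed

sublocale D: real_distribution D
proof (intro real_distribution.intro prob_spaceI real_distribution_axioms.intro)
  show "emeasure D (space D) = 1" using D_moment[of 0] by simp
qed (simp add: D_def)

lemma AE_D_nonneg: "AE x in D. 0 \<le> x"
  unfolding D_def by (subst AE_density) auto

text \<open>Monotone paths started at 0 give only nonnegativity; the value 0 is excluded because the
  law has a Lebesgue density.\<close>

lemma AE_pos:
  assumes "0 < x"
  shows "AE \<omega> in M. 0 < \<tau> x \<omega>"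
proof -
  have d: "distributed M lborel (\<tau> x) (\<lambda>s. ennreal (h s x))"
    using dens assms by (simp add: continuous_density_def)
  have "AE s in lborel. 0 < ennreal (h s x) \<longrightarrow> s \<noteq> (0::real)"
    using AE_lborel_singleton[of 0] by eventually_elim simp
  then have "AE \<omega> in M. \<tau> x \<omega> \<noteq> 0"
    by (subst distributed_AE2[OF d]) auto
  with AE_nonneg[OF less_imp_le[OF assms]] show ?thesis by eventually_elim auto
qed

lemma distr_inverse_power:
  assumes "0 < x"
  shows "distr M borel (\<lambda>\<omega>. x * \<tau> x \<omega> powr - \<nu>) = D"
proof (rule real_distribution_eq_if_moments_eq[where a = "\<lambda>k. fact k / Gamma (1 + \<nu> * real k)"])
  have [measurable]: "\<tau> x \<in> borel_measurable M" using measurable_X assms by simp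
  show "real_distribution (distr M borel (\<lambda>\<omega>. x * \<tau> x \<omega> powr - \<nu>))"
    by (intro real_distribution_distr) measurable
  show "AE y in distr M borel (\<lambda>\<omega>. x * \<tau> x \<omega> powr - \<nu>). 0 \<le> y"
    using assms by (subst AE_distr_iff) auto
  show "(\<integral>\<^sup>+y. ennreal (y ^ k) \<partial>distr M borel (\<lambda>\<omega>. x * \<tau> x \<omega> powr - \<nu>))
      = ennreal (fact k / Gamma (1 + \<nu> * real k))" for k
    using nn_integral_inverse_moment[OF assms AE_pos[OF assms], of k] by (subst nn_integral_distr) auto
  show "0 \<le> fact k / Gamma (1 + \<nu> * real k)" for k
  proof -
    have "0 < 1 + \<nu> * real k" using index by (simp add: add_pos_nonneg)
    then show ?thesis by (simp add: less_imp_le)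
  qed
  show "summable (\<lambda>k. fact k / Gamma (1 + \<nu> * real k) * R ^ k / fact k)" if "0 < R" for R
    using summable_power_div_Gamma[of "n + 1" R] that by (simp add: \<nu>)
qed (use D.real_distribution_axioms AE_D_nonneg D_moment in auto)

section \<open>Pointwise densities from derivatives of distribution functions\<close>

lemma DERIV_cdf_D: "0 < u \<Longrightarrow> (cdf D has_real_derivative K u) (at u)"
proof -
  assume u: "0 < u"
  have "continuous_on {0<..} (\<lambda>x. if 0 < x then K x else 0)"
    using K_cont by (rule continuous_on_eq) auto
  from DERIV_cdf_density[OF D.real_distribution_axioms D_def _ _ this u] u K_nonneg
  show ?thesis by simp
qed

lemma prob_greater:
  assumes "0 < x" "0 < s"
  shows "measure M {\<omega> \<in> space M. s < \<tau> x \<omega>} = cdf D (x * s powr - \<nu>)"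
proof -
  have [measurable]: "\<tau> x \<in> borel_measurable M" using measurable_X assms by simp
  let ?u = "x * s powr - \<nu>"
  have u: "0 < ?u" using assms by simp
  have "measure M {\<omega> \<in> space M. s < \<tau> x \<omega>} = measure M {\<omega> \<in> space M. x * \<tau> x \<omega> powr - \<nu> < ?u}"
  proof (rule finite_measure_eq_AE)
    show "AE \<omega> in M. (\<omega> \<in> {\<omega> \<in> space M. s < \<tau> x \<omega>}) = (\<omega> \<in> {\<omega> \<in> space M. x * \<tau> x \<omega> powr - \<nu> < ?u})"
      using AE_pos[OF assms(1)]
    proof eventually_elim
      case (elim \<omega>)
      have "s < \<tau> x \<omega> \<longleftrightarrow> \<tau> x \<omega> powr - \<nu> < s powr - \<nu>"
        using elim assms index powr_less_mono2_neg[of "- \<nu>" s "\<tau> x \<omega>"]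
          powr_less_mono2_neg[of "- \<nu>" "\<tau> x \<omega>" s] by (cases s "\<tau> x \<omega>" rule: linorder_cases) auto
      then show ?case using assms by simp
    qed
  qed measurable
  also have "\<dots> = measure (distr M borel (\<lambda>\<omega>. x * \<tau> x \<omega> powr - \<nu>)) {..<?u}"
    by (subst measure_distr) (auto simp: vimage_def Int_def intro!: arg_cong[where f = "measure M"])
  also have "\<dots> = measure D {..<?u}" by (simp add: distr_inverse_power[OF assms(1)])
  \<comment> \<open>The strict inequality yields the left limit of the distribution function, which
    equals its value because \<open>cdf D\<close> is differentiable at the point.\<close>
  also have "\<dots> = cdf D ?u"
  proof -
    have "isCont (cdf D) ?u" using DERIV_cdf_D[OF u] by (rule DERIV_isCont)
    then have "(cdf D \<longlongrightarrow> cdf D ?u) (at_left ?u)"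
      by (meson filterlim_at_split isCont_def)
    with D.cdf_at_left show ?thesis by (rule tendsto_unique[rotated]) simp
  qed
  finally show ?thesis .
qed

text \<open>Both sides are the derivative at s of the distribution function of \<tau> at time x.
  Continuity of \<open>h\<close> turns the almost everywhere identity of densities into one at every
  s > 0.\<close>

lemma density_eq:
  assumes "0 < x" "0 < s"
  shows "h s x = x * \<nu> * s powr (- \<nu> - 1) * K (x * s powr - \<nu>)"
proof -
  have [measurable]: "\<tau> x \<in> borel_measurable M" using measurable_X assms by simp
  have d: "distributed M lborel (\<tau> x) (\<lambda>s. ennreal (h s x))"
    and h: "\<And>s. 0 \<le> h s x" "continuous_on {0<..} (\<lambda>s. h s x)"
    using dens assms by (auto simp: continuous_density_def)
  let ?P = "distr M borel (\<tau> x)"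
  have P: "real_distribution ?P" by (intro real_distribution_distr) measurable
  have "(\<lambda>s. h s x) \<in> borel_measurable borel"
    using distributed_real_measurable[OF _ d] h by simp
  from DERIV_cdf_density[OF P distr_borel_eq_density[OF d] this h assms(2)]
  have "(cdf ?P has_real_derivative h s x) (at s)" .
  moreover have "(cdf ?P has_real_derivative x * \<nu> * s powr (- \<nu> - 1) * K (x * s powr - \<nu>)) (at s)"
  proof (rule has_field_derivative_transform_within_open[of _ _ _ "{0<..}"])
    have "((\<lambda>s. x * s powr - \<nu>) has_real_derivative x * (- \<nu> * s powr (- \<nu> - 1))) (at s)"
      using assms by (auto intro!: derivative_eq_intros)
    from DERIV_chain2[OF DERIV_cdf_D this] assms
    have "((\<lambda>s. cdf D (x * s powr - \<nu>)) has_real_derivative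
        K (x * s powr - \<nu>) * (x * (- \<nu> * s powr (- \<nu> - 1)))) (at s)" by simp
    from DERIV_diff[OF DERIV_const[of 1] this]
    show "((\<lambda>s. 1 - cdf D (x * s powr - \<nu>)) has_real_derivative
        x * \<nu> * s powr (- \<nu> - 1) * K (x * s powr - \<nu>)) (at s)" by (simp add: mult_ac)
    show "1 - cdf D (x * s powr - \<nu>) = cdf ?P s" if "s \<in> {0<..}" for s
    proof -
      have "cdf ?P s = measure M {\<omega> \<in> space M. \<tau> x \<omega> \<le> s}"
        unfolding cdf_def by (subst measure_distr) (auto simp: vimage_def Int_def intro!: arg_cong[where f = "measure M"])
      also have "\<dots> = 1 - measure M {\<omega> \<in> space M. s < \<tau> x \<omega>}"
        by (subst prob_compl[symmetric]) (auto intro!: arg_cong[where f = "measure M"])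
      finally show ?thesis using prob_greater[of x s] assms that by simp
    qed
  qed (use assms in auto)
  ultimately show ?thesis by (rule DERIV_unique)
qed

lemma inverse_density_eq:
  assumes "0 < x" "0 < t"
  shows "inverse_density h x t = t powr - \<nu> * K (x * t powr - \<nu>)"
proof -
  obtain K' C where K': "\<And>x. 0 < x \<Longrightarrow> (K has_real_derivative K' x) (at x)"
    and K'_cont: "\<And>x. 0 < x \<Longrightarrow> isCont K' x"
    and C: "\<And>x. 0 < x \<Longrightarrow> \<bar>K x\<bar> \<le> C" "\<And>x. 0 < x \<Longrightarrow> \<bar>x * K' x\<bar> \<le> real (n + 1) * C"
    using K_smooth by metis
  define u where "u = (\<lambda>s. x * s powr - \<nu>)"
  \<comment> \<open>\<open>q\<close> plays two roles: it is the partial derivative of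
    \<open>h\<close> in x, and it is the derivative of \<open>F\<close> in s. The integral is
    therefore an increment of \<open>F\<close>.\<close>
  define q where "q = (\<lambda>s. \<nu> * s powr (- \<nu> - 1) * (K (u s) + u s * K' (u s)))"
  define F where "F = (\<lambda>s. - (s powr - \<nu> * K (u s)))"
  have u_pos: "0 < u s" if "0 < s" for s using that assms by (simp add: u_def)
  have deriv_h: "deriv (\<lambda>y. h s y) x = q s" if s: "0 < s" for s
  proof (rule DERIV_imp_deriv, rule has_field_derivative_transform_within_open[of _ _ _ "{0<..}"])
    have "((\<lambda>y. y * s powr - \<nu>) has_real_derivative s powr - \<nu>) (at x)"
      by (auto intro!: derivative_eq_intros)
    from DERIV_chain2[OF K' this] u_pos[OF s]
    have "((\<lambda>y. K (y * s powr - \<nu>)) has_real_derivative K' (u s) * s powr - \<nu>) (at x)"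
      by (simp add: u_def)
    then have "((\<lambda>y. y * \<nu> * s powr (- \<nu> - 1) * K (y * s powr - \<nu>)) has_real_derivative
        \<nu> * s powr (- \<nu> - 1) * K (u s) + K' (u s) * s powr - \<nu> * (x * \<nu> * s powr (- \<nu> - 1))) (at x)"
      by (auto intro!: derivative_eq_intros simp: u_def)
    then show "((\<lambda>y. y * \<nu> * s powr (- \<nu> - 1) * K (y * s powr - \<nu>)) has_real_derivative q s) (at x)"
      by (simp add: q_def u_def algebra_simps)
  qed (use assms s density_eq in auto)
  have DERIV_u: "(u has_real_derivative x * (- \<nu> * s powr (- \<nu> - 1))) (at s)" if "0 < s" for s
    unfolding u_def using that by (auto intro!: derivative_eq_intros)
  have DERIV_F: "(F has_real_derivative q s) (at s)" if s: "0 < s" for s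
  proof -
    have "((\<lambda>s. s powr - \<nu>) has_real_derivative - \<nu> * s powr (- \<nu> - 1)) (at s)"
      using s by (auto intro!: derivative_eq_intros)
    from DERIV_minus[OF DERIV_mult[OF this DERIV_chain2[OF K' DERIV_u]]] u_pos[OF s] s
    show ?thesis unfolding F_def q_def u_def by (simp add: algebra_simps)
  qed
  have q_cont: "isCont q s" if s: "0 < s" for s
  proof -
    have "isCont u s" using DERIV_u[OF s] by (rule DERIV_isCont)
    moreover have "isCont K (u s)" using K'[OF u_pos[OF s]] by (rule DERIV_isCont)
    ultimately show ?thesis
      unfolding q_def using s K'_cont[OF u_pos[OF s]]
      by (intro continuous_intros isCont_o2[where f = u and g = K] isCont_o2[where f = u and g = K']) auto
  qed
  \<comment> \<open>Boundedness of K and of u K'(u) leaves the decay s^(-\<nu>-1), integrable at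
    infinity.\<close>
  have q_bound: "\<bar>q s\<bar> \<le> \<nu> * (C + real (n + 1) * C) * s powr (- \<nu> - 1)" if s: "0 < s" for s
  proof -
    have "\<bar>K (u s) + u s * K' (u s)\<bar> \<le> C + real (n + 1) * C"
      using C[OF u_pos[OF s]] by linarith
    then have "\<nu> * s powr (- \<nu> - 1) * \<bar>K (u s) + u s * K' (u s)\<bar>
        \<le> \<nu> * s powr (- \<nu> - 1) * (C + real (n + 1) * C)"
      using index by (intro mult_left_mono) auto
    then show ?thesis using index by (simp add: q_def abs_mult mult_ac)
  qed
  have int: "set_integrable lborel {t<..} q"
    unfolding set_integrable_def
  proof (rule Bochner_Integration.integrable_bound)
    have "((\<lambda>s. s powr (- \<nu> - 1)) has_integral - (t powr (- \<nu> - 1 + 1)) / (- \<nu> - 1 + 1)) {t..}"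
      using index assms by (intro has_integral_powr_to_inf) auto
    then have "(\<integral>\<^sup>+s. ennreal (s powr (- \<nu> - 1)) * indicator {t..} s \<partial>lborel) < \<infinity>"
      by (subst nn_integral_has_integral_lebesgue') auto
    also have "(\<integral>\<^sup>+s. ennreal (s powr (- \<nu> - 1)) * indicator {t..} s \<partial>lborel)
        = (\<integral>\<^sup>+s. ennreal (indicator {t..} s * s powr (- \<nu> - 1)) \<partial>lborel)"
      by (intro nn_integral_cong) (auto simp: indicator_def)
    finally have "integrable lborel (\<lambda>s. indicator {t..} s * s powr (- \<nu> - 1))"
      by (intro integrableI_nonneg) auto
    then show "integrable lborel (\<lambda>s. \<nu> * (C + real (n + 1) * C) * (indicator {t..} s * s powr (- \<nu> - 1)))"
      by (rule integrable_mult_right)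
    have "continuous_on {t<..} q"
      using q_cont assms by (intro continuous_at_imp_continuous_on) auto
    then show "(\<lambda>s. indicator {t<..} s *\<^sub>R q s) \<in> borel_measurable lborel"
      using borel_measurable_continuous_on_indicator[of "{t<..}" q] by simp
    show "AE s in lborel. norm (indicator {t<..} s *\<^sub>R q s)
        \<le> norm (\<nu> * (C + real (n + 1) * C) * (indicator {t..} s * s powr (- \<nu> - 1)))"
      using q_bound assms by (intro AE_I2) (auto simp: indicator_def intro: order_trans[OF _ abs_ge_self])
  qed
  \<comment> \<open>As s grows, u(s) tends to 0, so boundedness of \<open>K\<close> near 0 is what
    makes the boundary term vanish.\<close>
  have lim: "(F \<longlongrightarrow> 0) at_top"
  proof (rule Lim_null_comparison)
    show "\<forall>\<^sub>F s in at_top. norm (F s) \<le> s powr - \<nu> * C"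
      using eventually_gt_at_top[of 0]
    proof eventually_elim
      case (elim s)
      then show ?case using C(1)[OF u_pos[OF elim]] by (simp add: F_def abs_mult mult_left_mono)
    qed
    have "((\<lambda>s::real. s powr - \<nu>) \<longlongrightarrow> 0) at_top"
      using index by (intro tendsto_neg_powr filterlim_ident) auto
    then show "((\<lambda>s. s powr - \<nu> * C) \<longlongrightarrow> 0) at_top" by (rule tendsto_mult_left_zero)
  qed
  have "(LBINT s=ereal t..\<infinity>. q s) = 0 - F t"
  proof (rule interval_integral_FTC_integrable)
    show "(F has_vector_derivative q s) (at s)" if "ereal t < ereal s" for s
      using DERIV_F[of s] that assms by (simp add: has_real_derivative_iff_has_vector_derivative)
    have "isCont F t" using DERIV_F[OF assms(2)] by (rule DERIV_isCont)
    then show "((F \<circ> real_of_ereal) \<longlongrightarrow> F t) (at_right (ereal t))"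
      unfolding ereal_tendsto_simps by (simp add: isCont_def filterlim_at_split)
    show "((F \<circ> real_of_ereal) \<longlongrightarrow> 0) (at_left \<infinity>)"
      unfolding ereal_tendsto_simps by (rule lim)
  qed (use q_cont assms int in auto)
  moreover have "inverse_density h x t = (LBINT s=ereal t..\<infinity>. q s)"
    unfolding inverse_density_def interval_integral_to_infinity_eq
    using assms by (intro set_lebesgue_integral_cong) (auto simp: deriv_h)
  ultimately show ?thesis by (simp add: F_def u_def)
qed

text \<open>Here \<open>\<psi>\<close> (n+1) t = t^\<nu> (n+1), so homogeneity with c = t^\<nu>
  reduces every t to t = 1.\<close>

lemma g_conv_eq_K:
  assumes "0 < x" "0 < t"
  shows "g_conv (real (n + 1)) \<mu>s x (\<psi> (n + 1) t) = t powr - \<nu> * K (x * t powr - \<nu>)"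
proof -
  have "g_conv (real (n + 1)) \<mu>s x (\<psi> (n + 1) t)
      = g_conv (real (n + 1)) \<mu>s (t powr \<nu> * (x * t powr - \<nu>)) (t powr \<nu> * real (n + 1))"
    using assms by (simp add: \<psi>_def \<nu> powr_minus mult_ac)
  also have "\<dots> = K (x * t powr - \<nu>) / t powr \<nu>"
    unfolding K_def using assms by (intro g_conv_scale) auto
  finally show ?thesis by (simp add: powr_minus_divide)
qed

text \<open>The hypothesis on \<open>L\<close> gives P(L t < x) for x > 0 only. The work is to pass
  to P(L t \<le> x) for every real x; comparing distribution functions then identifies the
  density.\<close>

lemma distributed_inverse:
  assumes L: "inverse_process M \<tau> L" and t: "0 < t"
  shows "distributed M lborel (L t)
           (\<lambda>x. ennreal (if 0 < x then g_conv (real (n + 1)) \<mu>s x (\<psi> (n + 1) t) else 0))"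
proof -
  let ?c = "t powr \<nu>"
  let ?K = "\<lambda>x. if 0 < x then K x else 0"
  have c: "0 < ?c" using t by simp
  have [measurable]: "L t \<in> borel_measurable M" using L t by (simp add: inverse_process_def)
  have less: "measure M {\<omega> \<in> space M. L t \<omega> < x} = cdf D (x / ?c)" if "0 < x" for x
    using L t that prob_greater[of x t] by (simp add: inverse_process_def powr_minus_divide)
  have cdf_cont: "isCont (cdf D) x" for x
  proof (subst D.isCont_cdf)
    have "emeasure D {x} = 0"
      unfolding D_def by (subst emeasure_density) (auto intro!: nn_integral_zero' eventually_mono[OF AE_lborel_singleton[of x]] simp: indicator_def)
    then show "measure D {x} = 0" by (simp add: measure_def)
  qed
  have cdf_0: "cdf D 0 = 0"
  proof -
    have "emeasure D {..0} = 0"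
      unfolding D_def by (subst emeasure_density) (auto intro!: nn_integral_zero' simp: indicator_def)
    then show ?thesis by (simp add: cdf_def measure_def)
  qed
  \<comment> \<open>Approximation from the right: points y > x \<ge> 0 are positive, so the
    hypothesis applies to them. The case x = 0 is included on purpose.\<close>
  have upper: "measure M {\<omega> \<in> space M. L t \<omega> \<le> x} \<le> cdf D (x / ?c)" if x: "0 \<le> x" for x
  proof (rule tendsto_lowerbound)
    have "((\<lambda>y. cdf D (y / ?c)) \<longlongrightarrow> cdf D (x / ?c)) (at x)"
      using c by (intro isCont_tendsto_compose[OF cdf_cont] tendsto_intros) auto
    then show "((\<lambda>y. cdf D (y / ?c)) \<longlongrightarrow> cdf D (x / ?c)) (at_right x)"
      by (rule tendsto_mono[rotated]) (simp add: at_le)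
    show "\<forall>\<^sub>F y in at_right x. measure M {\<omega> \<in> space M. L t \<omega> \<le> x} \<le> cdf D (y / ?c)"
      using eventually_at_right_less[of x]
    proof eventually_elim
      case (elim y)
      then have "measure M {\<omega> \<in> space M. L t \<omega> \<le> x} \<le> measure M {\<omega> \<in> space M. L t \<omega> < y}"
        by (intro finite_measure_mono) auto
      then show ?case using elim x by (simp add: less)
    qed
  qed simp
  have cdf_L: "measure M {\<omega> \<in> space M. L t \<omega> \<le> x} = cdf D (x / ?c)" for x
  proof (cases "0 < x")
    case True
    have "measure M {\<omega> \<in> space M. L t \<omega> < x} \<le> measure M {\<omega> \<in> space M. L t \<omega> \<le> x}"
      by (intro finite_measure_mono) auto
    with upper[of x] less[OF True] True show ?thesis by simp
  next
    \<comment> \<open>The upper bound at 0 shows that L t puts no mass on the nonpositive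
      half-line.\<close>
    case False
    have "measure M {\<omega> \<in> space M. L t \<omega> \<le> x} \<le> measure M {\<omega> \<in> space M. L t \<omega> \<le> 0}"
      using False by (intro finite_measure_mono) auto
    also have "\<dots> \<le> 0" using upper[of 0] cdf_0 by simp
    finally have "measure M {\<omega> \<in> space M. L t \<omega> \<le> x} = 0" by (simp add: antisym)
    moreover have "cdf D (x / ?c) = 0"
      using D.cdf_nondecreasing[of "x / ?c" 0] D.cdf_nonneg[of "x / ?c"] cdf_0 False c
      by (simp add: divide_nonpos_pos)
    ultimately show ?thesis by simp
  qed
  have eq: "(if 0 < x then g_conv (real (n + 1)) \<mu>s x (\<psi> (n + 1) t) else 0) = ?K (x / ?c) / ?c" for x
    using g_conv_eq_K[of x t] t c by (auto simp: powr_minus_divide zero_less_divide_iff)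
  have "distributed M lborel (L t) (\<lambda>x. ennreal (?K (x / ?c) / ?c))"
  proof (rule distributedI_borel_atMost)
    show "(\<integral>\<^sup>+y. ennreal (?K (y / ?c) / ?c * indicator {..x} y) \<partial>lborel) = ennreal (cdf D (x / ?c))" for x
    proof -
      have "(\<integral>\<^sup>+y. ennreal (?K (y / ?c) / ?c * indicator {..x} y) \<partial>lborel)
          = (\<integral>\<^sup>+y. ennreal (?K (y / ?c) / ?c) * indicator {..x} y \<partial>lborel)"
        by (intro nn_integral_cong) (auto simp: indicator_def)
      also have "\<dots> = emeasure D {..x / ?c}"
        unfolding D_def using nn_integral_rescaled_density_atMost[OF c, of ?K x]
        by (subst emeasure_density) auto
      finally show ?thesis by (simp add: cdf_def D.emeasure_eq_measure)
    qed
    show "emeasure M {\<omega> \<in> space M. L t \<omega> \<le> x} = ennreal (cdf D (x / ?c))" for x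
      by (simp add: emeasure_eq_measure cdf_L)
  qed (use c K_nonneg in auto)
  then show ?thesis by (simp only: eq)
qed

end

theorem lemma3:
  fixes M :: "'a measure"
    and \<tau> L :: "real \<Rightarrow> 'a \<Rightarrow> real"
    and h :: "real \<Rightarrow> real \<Rightarrow> real"
    and n :: nat
    and \<nu> :: real
    and \<mu>s :: "real list"
  assumes "n \<ge> 1"
    and "\<nu> = 1 / real (n + 1)"
    and "\<mu>s = map (\<lambda>j. real j * \<nu>) [1..<n + 1]"
    and "stable_subordinator M \<tau> \<nu>"
    and "continuous_density M \<tau> h"
    and "inverse_process M \<tau> L"
  shows "(\<forall>t>0. distributed M lborel (L t)
             (\<lambda>x. ennreal (if 0 < x then g_conv (real (n + 1)) \<mu>s x (\<psi> (n + 1) t) else 0))) \<and>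
         (\<forall>x>0. \<forall>t>0. inverse_density h x t = g_conv (real (n + 1)) \<mu>s x (\<psi> (n + 1) t))"
proof -
  interpret stable_root_subordinator M \<tau> \<nu> n h \<mu>s
    using assms by (intro stable_root_subordinator.intro stable_root_subordinator_axioms.intro)
  show ?thesis
    using distributed_inverse[OF assms(6)] inverse_density_eq g_conv_eq_K by auto
qed

end
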